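(* Let $\mathbb{S}^3$ carry the round metric and let $V$ be a curl eigenfield on $\mathbb{S}^3$, with eigenvalue $\lambda$, such that $|V|=1$ everywhere. Then $\lambda=\pm2$ and $V$ is isometric to the Hopf field $R$ (or to the anti-Hopf field $R'$), i.e. there is an isometry of $\mathbb{S}^3$ whose push-forward maps $V$ to $R$ (or to $R'$).
   Context: All objects are smooth. On an oriented Riemannian 3-manifold $(M,g)$ with volume form $\mathrm{vol}_g$, the curl of a vector field $V$ with metric-dual 1-form $\alpha$ is the vector field $\operatorname{curl}V$ with $i_{\operatorname{curl}V}\mathrm{vol}_g=d\alpha$. A curl eigenfield with eigenvalue $\lambda$ is a vector field $V\not\equiv0$ with $\operatorname{curl}V=\lambda V$ for a real constant $\lambda\neq0$. $\mathbb{S}^3=\{(z_1,z_2)\in\mathbb{C}^2:|z_1|^2+|z_2|^2=1\}$ has the round (unit sphere) metric, $z_j=x_j+iy_j$. The Hopf field is $R=-y_1\partial_{x_1}+x_1\partial_{y_1}-y_2\partial_{x_2}+x_2\partial_{y_2}$ and the anti-Hopf field is $R'=-y_1\partial_{x_1}+x_1\partial_{y_1}+y_2\partial_{x_2}-x_2\partial_{y_2}$. The orientation of $\mathbb{S}^3$ is chosen so that $\operatorname{curl}R=2R$ and $\operatorname{curl}R'=-2R'$. *)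

theory Defs
  imports "HOL-Analysis.Analysis"
begin

type_synonym C2 = "complex \<times> complex"

definition S3 :: "C2 set"
  where "S3 = sphere 0 1"

definition tangent_S3 :: "C2 \<Rightarrow> C2 set"
  where "tangent_S3 x = {u. x \<bullet> u = 0}"

fun Ck_on :: "nat \<Rightarrow> ('a::euclidean_space \<Rightarrow> 'b::euclidean_space) \<Rightarrow> 'a set \<Rightarrow> bool"
  where
    "Ck_on 0 f U \<longleftrightarrow> continuous_on U f"
  | "Ck_on (Suc k) f U \<longleftrightarrow> (\<forall>x\<in>U. f differentiable (at x)) \<and>
       (\<forall>v. Ck_on k (\<lambda>x. frechet_derivative f (at x) v) U)"

text \<open>A map on the embedded submanifold is smooth iff it is the restriction of a
  smooth map on an open neighbourhood.  Values off the sphere are irrelevant here and below.\<close>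

definition smooth_S3 :: "(C2 \<Rightarrow> C2) \<Rightarrow> bool"
  where "smooth_S3 f \<longleftrightarrow>
    (\<exists>U F. open U \<and> S3 \<subseteq> U \<and> (\<forall>k. Ck_on k F U) \<and> (\<forall>x\<in>S3. F x = f x))"

definition vector_field_S3 :: "(C2 \<Rightarrow> C2) \<Rightarrow> bool"
  where "vector_field_S3 V \<longleftrightarrow> smooth_S3 V \<and> (\<forall>x\<in>S3. V x \<in> tangent_S3 x)"

text \<open>The derivative within the sphere is determined only on tangent vectors (see
  \<open>diff_S3_eq\<close>), so \<open>diff_S3 f x u\<close> is to be used for \<open>u \<in> tangent_S3 x\<close> only.\<close>

definition diff_S3 :: "(C2 \<Rightarrow> 'b::real_normed_vector) \<Rightarrow> C2 \<Rightarrow> C2 \<Rightarrow> 'b"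
  where "diff_S3 f x = frechet_derivative f (at x within S3)"

lemma diff_S3_eq:
  assumes f: "(f has_derivative f') (at x within S3)" and x: "x \<in> S3" and u: "u \<in> tangent_S3 x"
  shows "diff_S3 f x u = f' u"
proof (cases "u = 0")
  case True
  have "(f has_derivative diff_S3 f x) (at x within S3)"
    unfolding diff_S3_def using f frechet_derivative_works differentiable_def by blast
  then show ?thesis
    using f True by (metis has_derivative_bounded_linear bounded_linear.linear linear_0)
next
  case False
  define w where "w = u /\<^sub>R norm u"
  have w: "w \<bullet> w = 1" "x \<bullet> w = 0" "u = norm u *\<^sub>R w"
    using False u by (auto simp: w_def tangent_S3_def dot_square_norm power2_eq_square field_simps)
  have x1: "x \<bullet> x = 1"
    using x by (simp add: S3_def dot_square_norm)
  define c where "c t = cos t *\<^sub>R x + sin t *\<^sub>R w" for t :: real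
  have c: "(c has_derivative (\<lambda>t. t *\<^sub>R w)) (at 0)"
    unfolding c_def by (auto intro!: derivative_eq_intros)
  have "c t \<bullet> c t = 1" for t
    using w x1 by (simp add: c_def inner_add_left inner_add_right inner_commute power2_eq_square[symmetric])
  then have cS: "range c \<subseteq> S3"
    by (auto simp: S3_def norm_eq_sqrt_inner)
  have c0: "c 0 = x" by (simp add: c_def)
  have *: "g' w = h' w" if "(f has_derivative g') (at x within S3)" "(f has_derivative h') (at x within S3)"
    for g' h'
  proof -
    have "((f \<circ> c) has_derivative (k' \<circ> (\<lambda>t. t *\<^sub>R w))) (at 0)"
      if "(f has_derivative k') (at x within S3)" for k'
      using diff_chain_within[OF c, of f k'] has_derivative_subset[OF that cS] c0 by simp
    from has_derivative_unique[OF this[OF that(1)] this[OF that(2)]]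
    show ?thesis by (metis comp_apply scaleR_one)
  qed
  have D: "(f has_derivative diff_S3 f x) (at x within S3)"
    unfolding diff_S3_def using f frechet_derivative_works differentiable_def by blast
  show ?thesis
    using *[OF D f] w(3) f D
    by (metis has_derivative_bounded_linear bounded_linear.linear linear_scale)
qed

text \<open>One-forms on the sphere are given as \<open>\<alpha> :: C2 \<Rightarrow> C2 \<Rightarrow> real\<close>, linear in the second
  argument.  The formula below is the standard coordinate expression for \<open>d\<close> of an extension of
  \<open>\<alpha>\<close> to a neighbourhood, pulled back to the sphere: for tangent \<open>u\<close> and \<open>w\<close>
  only tangential derivatives of the coefficients occur, so no extension has to be chosen.\<close>

definition ext_deriv_S3 :: "(C2 \<Rightarrow> C2 \<Rightarrow> real) \<Rightarrow> C2 \<Rightarrow> C2 \<Rightarrow> C2 \<Rightarrow> real"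
  where "ext_deriv_S3 \<alpha> x u w = diff_S3 (\<lambda>y. \<alpha> y w) x u - diff_S3 (\<lambda>y. \<alpha> y u) x w"

definition flat_S3 :: "(C2 \<Rightarrow> C2) \<Rightarrow> C2 \<Rightarrow> C2 \<Rightarrow> real"
  where "flat_S3 V x u = V x \<bullet> u"

definition coords :: "C2 \<Rightarrow> real^4"
  where "coords z = vector [Re (fst z), Im (fst z), Re (snd z), Im (snd z)]"

text \<open>Outward normal first, with respect to the coordinates \<open>x\<^sub>1, y\<^sub>1, x\<^sub>2, y\<^sub>2\<close>.  This is the
  orientation for which \<open>curl R = 2 R\<close> and \<open>curl R' = - 2 R'\<close>; see \<open>has_curl_hopf\<close> and
  \<open>has_curl_anti_hopf\<close>.\<close>

definition vol_S3 :: "C2 \<Rightarrow> C2 \<Rightarrow> C2 \<Rightarrow> C2 \<Rightarrow> real"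
  where "vol_S3 x u v w = det (vector [coords x, coords u, coords v, coords w] :: real^4^4)"

text \<open>\<open>has_curl V W\<close> says \<open>curl V = W\<close>, i.e. \<open>i\<^sub>W vol = d (V flat)\<close>; such \<open>W\<close> is unique on
  the sphere (\<open>has_curl_unique\<close>).  \<open>V\<close> is meant to be smooth.\<close>

definition has_curl :: "(C2 \<Rightarrow> C2) \<Rightarrow> (C2 \<Rightarrow> C2) \<Rightarrow> bool"
  where "has_curl V W \<longleftrightarrow> vector_field_S3 W \<and>
    (\<forall>x\<in>S3. \<forall>u\<in>tangent_S3 x. \<forall>w\<in>tangent_S3 x.
       vol_S3 x (W x) u w = ext_deriv_S3 (flat_S3 V) x u w)"

lemma vector_4_nth:
  "(vector [a, b, c, d] :: 'a::zero^4) $ 1 = a" "(vector [a, b, c, d] :: 'a^4) $ 2 = b"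
  "(vector [a, b, c, d] :: 'a^4) $ 3 = c" "(vector [a, b, c, d] :: 'a^4) $ 4 = d"
  by (simp_all add: vector_def)

lemma det_4:
  "det (A::'a::comm_ring_1^4^4) =
    A$1$1 * (A$2$2 * A$3$3 * A$4$4 + A$2$3 * A$3$4 * A$4$2 + A$2$4 * A$3$2 * A$4$3
      - A$2$2 * A$3$4 * A$4$3 - A$2$3 * A$3$2 * A$4$4 - A$2$4 * A$3$3 * A$4$2)
    - A$1$2 * (A$2$1 * A$3$3 * A$4$4 + A$2$3 * A$3$4 * A$4$1 + A$2$4 * A$3$1 * A$4$3
      - A$2$1 * A$3$4 * A$4$3 - A$2$3 * A$3$1 * A$4$4 - A$2$4 * A$3$3 * A$4$1)
    + A$1$3 * (A$2$1 * A$3$2 * A$4$4 + A$2$2 * A$3$4 * A$4$1 + A$2$4 * A$3$1 * A$4$2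
      - A$2$1 * A$3$4 * A$4$2 - A$2$2 * A$3$1 * A$4$4 - A$2$4 * A$3$2 * A$4$1)
    - A$1$4 * (A$2$1 * A$3$2 * A$4$3 + A$2$2 * A$3$3 * A$4$1 + A$2$3 * A$3$1 * A$4$2
      - A$2$1 * A$3$3 * A$4$2 - A$2$2 * A$3$1 * A$4$3 - A$2$3 * A$3$2 * A$4$1)"
proof -
  have f1: "finite {2::4, 3, 4}" "1 \<notin> {2::4, 3, 4}"
    and f2: "finite {3::4, 4}" "2 \<notin> {3::4, 4}"
    and f3: "finite {4::4}" "3 \<notin> {4::4}"
    by auto
  show ?thesis
    unfolding det_def UNIV_4
    unfolding sum_over_permutations_insert[OF f1] sum_over_permutations_insert[OF f2]
      sum_over_permutations_insert[OF f3] permutes_sing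
    by (simp add: sign_swap_id permutation_swap_id permutation_compose sign_compose sign_id
        swap_id_eq algebra_simps)
qed

lemma has_curl_unique:
  assumes W: "has_curl V W" and W': "has_curl V W'" and x: "x \<in> S3"
  shows "W x = W' x"
proof -
  define d where "d = W x - W' x"
  have xx: "x \<bullet> x = 1"
    using x by (simp add: S3_def dot_square_norm)
  have xd: "x \<bullet> d = 0"
    using W W' x by (simp add: d_def has_curl_def vector_field_S3_def tangent_S3_def inner_diff_right)
  have diff: "vol_S3 x (a - b) u w = vol_S3 x a u w - vol_S3 x b u w" for a b u w
    by (simp add: vol_S3_def det_4 vector_4_nth coords_def algebra_simps)
  have shift: "vol_S3 x d (u - a *\<^sub>R x) w = vol_S3 x d u w"
    "vol_S3 x d u (w - a *\<^sub>R x) = vol_S3 x d u w" for a u w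
    by (simp_all add: vol_S3_def det_4 vector_4_nth coords_def algebra_simps)
  have 0: "vol_S3 x d u w = 0" for u w
  proof -
    have "v - (x \<bullet> v) *\<^sub>R x \<in> tangent_S3 x" for v
      using xx by (simp add: tangent_S3_def inner_diff_right)
    then have "vol_S3 x d (u - (x \<bullet> u) *\<^sub>R x) (w - (x \<bullet> w) *\<^sub>R x) = 0"
      using W W' x by (simp add: d_def diff has_curl_def)
    then show ?thesis by (simp add: shift)
  qed
  obtain x1 y1 x2 y2 d1 e1 d2 e2
    where e: "x = (Complex x1 y1, Complex x2 y2)" "d = (Complex d1 e1, Complex d2 e2)"
    by (metis complex_surj surj_pair)
  note v = vol_S3_def det_4 vector_4_nth coords_def e
  have m: "x1 * e1 = y1 * d1" "x1 * d2 = x2 * d1" "x1 * e2 = y2 * d1"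
    "y1 * d2 = x2 * e1" "y1 * e2 = y2 * e1" "x2 * e2 = y2 * d2"
    using 0[of "(0, 1)" "(0, \<i>)"] 0[of "(\<i>, 0)" "(0, \<i>)"] 0[of "(\<i>, 0)" "(0, 1)"]
      0[of "(1, 0)" "(0, \<i>)"] 0[of "(1, 0)" "(0, 1)"] 0[of "(1, 0)" "(\<i>, 0)"]
    by (simp_all add: v algebra_simps)
  have "x1 * x1 + y1 * y1 + x2 * x2 + y2 * y2 = 1" "x1 * d1 + y1 * e1 + x2 * d2 + y2 * e2 = 0"
    using xx xd by (simp_all add: e inner_complex_def)
  with m have "d1 = 0" "e1 = 0" "d2 = 0" "e2 = 0" by algebra+
  then show ?thesis using e(2) by (simp add: d_def complex_eq_iff prod_eq_iff)
qed

definition curl_eigenfield :: "(C2 \<Rightarrow> C2) \<Rightarrow> real \<Rightarrow> bool"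
  where "curl_eigenfield V c \<longleftrightarrow>
    vector_field_S3 V \<and> (\<exists>x\<in>S3. V x \<noteq> 0) \<and> c \<noteq> 0 \<and> has_curl V (\<lambda>x. c *\<^sub>R V x)"

definition hopf :: "C2 \<Rightarrow> C2"
  where "hopf = (\<lambda>(z1, z2). (Complex (- Im z1) (Re z1), Complex (- Im z2) (Re z2)))"

definition anti_hopf :: "C2 \<Rightarrow> C2"
  where "anti_hopf = (\<lambda>(z1, z2). (Complex (- Im z1) (Re z1), Complex (Im z2) (- Re z2)))"

lemma Ck_on_linear:
  assumes "bounded_linear f" shows "Ck_on k f U"
proof -
  have const: "Ck_on k (\<lambda>x. c) U" for k and c :: 'b
    by (induction k arbitrary: c) (auto simp: frechet_derivative_const)
  show ?thesis
  proof (cases k)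
    case 0
    then show ?thesis using assms by (simp add: linear_continuous_on)
  next
    case (Suc n)
    have "(f has_derivative f) (at x)" for x
      using assms by (rule bounded_linear_imp_has_derivative)
    then have "f differentiable (at x)" "frechet_derivative f (at x) = f" for x
      using differentiable_def frechet_derivative_at by (blast, metis)
    then show ?thesis using Suc const by simp
  qed
qed

lemma linear_hopf: "bounded_linear hopf" and linear_anti_hopf: "bounded_linear anti_hopf"
  unfolding linear_conv_bounded_linear[symmetric]
  by (auto intro!: linearI simp: hopf_def anti_hopf_def complex_eq_iff split: prod.splits)

lemma ext_deriv_flat_linear:
  assumes "bounded_linear V" "x \<in> S3" "u \<in> tangent_S3 x" "w \<in> tangent_S3 x"
  shows "ext_deriv_S3 (flat_S3 V) x u w = V u \<bullet> w - V w \<bullet> u"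
proof -
  have "((\<lambda>y. V y \<bullet> a) has_derivative (\<lambda>y. V y \<bullet> a)) (at x within S3)" for a
    by (rule bounded_linear_imp_has_derivative)
      (use assms(1) in \<open>simp add: bounded_linear_inner_left_comp\<close>)
  from diff_S3_eq[OF this assms(2)] show ?thesis
    using assms(3,4) by (simp add: ext_deriv_S3_def flat_S3_def)
qed

lemma vol_S3_hopf_identity:
  "vol_S3 x (hopf x) u w =
    (x \<bullet> x) * (hopf u \<bullet> w) - ((x \<bullet> u) * (hopf x \<bullet> w) - (x \<bullet> w) * (hopf x \<bullet> u))"
  "vol_S3 x (anti_hopf x) u w =
    - (x \<bullet> x) * (anti_hopf u \<bullet> w) + ((x \<bullet> u) * (anti_hopf x \<bullet> w) - (x \<bullet> w) * (anti_hopf x \<bullet> u))"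
  unfolding vol_S3_def det_4 vector_4_nth coords_def
  by (simp_all add: hopf_def anti_hopf_def inner_prod_def inner_complex_def case_prod_beta algebra_simps)

lemma vol_S3_hopf:
  assumes x: "x \<in> S3" and u: "u \<in> tangent_S3 x" and w: "w \<in> tangent_S3 x"
  shows "vol_S3 x (hopf x) u w = hopf u \<bullet> w" "vol_S3 x (anti_hopf x) u w = - (anti_hopf u \<bullet> w)"
proof -
  have n: "x \<bullet> x = 1" and t: "x \<bullet> u = 0" "x \<bullet> w = 0"
    using x u w by (simp_all add: S3_def tangent_S3_def dot_square_norm)
  show "vol_S3 x (hopf x) u w = hopf u \<bullet> w" "vol_S3 x (anti_hopf x) u w = - (anti_hopf u \<bullet> w)"
    using vol_S3_hopf_identity[of x u w] n t by simp_all
qed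

lemma vector_field_linear:
  assumes "bounded_linear V" "\<And>x. x \<bullet> V x = 0"
  shows "vector_field_S3 V"
  unfolding vector_field_S3_def smooth_S3_def tangent_S3_def
  using Ck_on_linear[OF assms(1)] assms(2) by auto

lemma has_curl_hopf: "has_curl hopf (\<lambda>x. 2 *\<^sub>R hopf x)"
  and has_curl_anti_hopf: "has_curl anti_hopf (\<lambda>x. - 2 *\<^sub>R anti_hopf x)"
proof -
  have scale: "vol_S3 x (c *\<^sub>R v) u w = c * vol_S3 x v u w" for x c v u w
    by (simp add: vol_S3_def det_4 vector_4_nth coords_def algebra_simps)
  have skew: "hopf u \<bullet> w = - (hopf w \<bullet> u)" "anti_hopf u \<bullet> w = - (anti_hopf w \<bullet> u)" for u w
    by (auto simp: hopf_def anti_hopf_def inner_complex_def split: prod.splits)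
  have skew': "hopf u \<bullet> w - hopf w \<bullet> u = 2 * (hopf u \<bullet> w)"
    "anti_hopf u \<bullet> w - anti_hopf w \<bullet> u = 2 * (anti_hopf u \<bullet> w)" for u w
    using skew[of w u] by simp_all
  have perp: "x \<bullet> hopf x = 0" "x \<bullet> anti_hopf x = 0" for x
    using skew[of x x] by (simp_all add: inner_commute)
  have "vector_field_S3 (\<lambda>x. c *\<^sub>R hopf x)" "vector_field_S3 (\<lambda>x. c *\<^sub>R anti_hopf x)" for c
    by (intro vector_field_linear bounded_linear_const_scaleR linear_hopf linear_anti_hopf,
        simp add: perp)+
  then show "has_curl hopf (\<lambda>x. 2 *\<^sub>R hopf x)" "has_curl anti_hopf (\<lambda>x. - 2 *\<^sub>R anti_hopf x)"
    unfolding has_curl_def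
    by (simp_all add: scale vol_S3_hopf ext_deriv_flat_linear linear_hopf linear_anti_hopf skew'
        del: scaleR_minus_left)
qed

definition isometry_S3 :: "(C2 \<Rightarrow> C2) \<Rightarrow> bool"
  where "isometry_S3 \<phi> \<longleftrightarrow>
    bij_betw \<phi> S3 S3 \<and> smooth_S3 \<phi> \<and> smooth_S3 (inv_into S3 \<phi>) \<and>
    (\<forall>x\<in>S3. \<forall>u\<in>tangent_S3 x. \<forall>w\<in>tangent_S3 x.
       diff_S3 \<phi> x u \<bullet> diff_S3 \<phi> x w = u \<bullet> w)"

definition pushforward_S3 :: "(C2 \<Rightarrow> C2) \<Rightarrow> (C2 \<Rightarrow> C2) \<Rightarrow> C2 \<Rightarrow> C2"
  where "pushforward_S3 \<phi> V y =
    (let x = inv_into S3 \<phi> y in diff_S3 \<phi> x (V x))"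

end

theory Submission
  imports Defs
begin

text \<open>The curl equation makes the orbits of \<open>V\<close> great circles, and its flow preserves
  \<open>d (V flat)\<close>; hence on the planes orthogonal to \<open>V\<close> the derivative of \<open>V\<close> has trace 0 and
  determinant 1. The two chiral parts of the bivector \<open>x \<and> V x\<close> are maps \<open>p\<close>, \<open>q\<close> from the sphere
  to \<open>S\<^sup>2\<close>, constant on orbits, and their differentials have determinants \<open>2 - lam\<close> and \<open>2 + lam\<close>.
  Distinct orbits are disjoint great circles, so the linking form \<open>p x \<bullet> p y - q x \<bullet> q y\<close> has no
  zeros off the set of pairs on a common orbit, and it has constant sign by connectedness.
  Therefore one of the two maps takes no antipodal pair of values. It is not onto, its differential
  is singular somewhere, and \<open>lam = 2\<close> or \<open>lam = - 2\<close> follows. The same matrix identities then make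
  the differential vanish everywhere, so this chiral part is constant, which means that \<open>V\<close> is the
  restriction of a linear complex structure.\<close>

subsection \<open>Volume form and chiral parts of bivectors\<close>

text \<open>The self-dual (\<open>s = 1\<close>) and anti-self-dual (\<open>s = - 1\<close>) parts of the bivector \<open>x \<and> v\<close>, in the
  normalisation in which they are unit vectors for orthonormal \<open>x\<close>, \<open>v\<close>.\<close>

definition chiral_part :: "real \<Rightarrow> C2 \<Rightarrow> C2 \<Rightarrow> real \<times> complex" where
  "chiral_part s x v =
    (if s = 1 then (v \<bullet> hopf x, snd v * fst x - fst v * snd x)
     else (v \<bullet> anti_hopf x, cnj (snd v) * fst x - fst v * cnj (snd x)))"

text \<open>The Gram determinant of two bivectors plus \<open>s\<close> times their wedge product:
  the polarised norm of a chiral part. Taking both signs of \<open>s\<close> separates the metric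
  term from the linking term \<open>vol_S3\<close>.\<close>

lemma inner_chiral_part:
  assumes "s = 1 \<or> s = -1"
  shows "chiral_part s x v \<bullet> chiral_part s y w =
    (x \<bullet> y) * (v \<bullet> w) - (x \<bullet> w) * (v \<bullet> y) + s * vol_S3 x v y w"
  using assms
  by (elim disjE)
    (simp_all add: chiral_part_def vol_S3_def det_4 vector_4_nth coords_def hopf_def anti_hopf_def
      inner_prod_def inner_complex_def case_prod_beta algebra_simps)

lemma bounded_bilinear_chiral_part: "bounded_bilinear (chiral_part s)"
  unfolding bilinear_conv_bounded_bilinear[symmetric] bilinear_def
  by (auto intro!: linearI simp: chiral_part_def hopf_def anti_hopf_def inner_prod_def
      inner_complex_def case_prod_beta complex_eq_iff algebra_simps)

lemma chiral_part_self: "chiral_part s v v = 0"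
  by (auto simp: chiral_part_def hopf_def anti_hopf_def inner_prod_def
      inner_complex_def case_prod_beta complex_eq_iff zero_prod_def algebra_simps)

lemma vol_S3_comb_left:
  "vol_S3 (a *\<^sub>R x + b *\<^sub>R y) (c *\<^sub>R x + d *\<^sub>R y) u w = (a * d - b * c) * vol_S3 x y u w"
  by (simp add: vol_S3_def det_4 vector_4_nth coords_def algebra_simps)

lemma vol_S3_comb_right:
  "vol_S3 x y (a *\<^sub>R u + b *\<^sub>R u') (c *\<^sub>R w + d *\<^sub>R w') =
    a * c * vol_S3 x y u w + a * d * vol_S3 x y u w' + b * c * vol_S3 x y u' w + b * d * vol_S3 x y u' w'"
  by (simp add: vol_S3_def det_4 vector_4_nth coords_def algebra_simps)

lemma vol_S3_swap_pairs: "vol_S3 u w x y = vol_S3 x y u w"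
  by (simp add: vol_S3_def det_4 vector_4_nth coords_def algebra_simps)

lemma vol_S3_scale: "vol_S3 x (c *\<^sub>R v) u w = c * vol_S3 x v u w"
  by (simp add: vol_S3_def det_4 vector_4_nth coords_def algebra_simps)

lemma vol_S3_combs_right:
  "vol_S3 x y (a *\<^sub>R x + b *\<^sub>R y + c *\<^sub>R u + d *\<^sub>R w) (a' *\<^sub>R x + b' *\<^sub>R y + c' *\<^sub>R u + d' *\<^sub>R w) =
    (c * d' - d * c') * vol_S3 x y u w"
  by (simp add: vol_S3_def det_4 vector_4_nth coords_def algebra_simps)

lemma vol_S3_repeat: "vol_S3 x y x w = 0" "vol_S3 x y y w = 0" "vol_S3 x y w w = 0"
  by (simp_all add: vol_S3_def det_4 vector_4_nth coords_def algebra_simps)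

lemma coords_inner: "coords u \<bullet> coords w = u \<bullet> w"
  by (simp add: coords_def inner_vec_def sum_4 vector_4_nth inner_prod_def inner_complex_def)

lemma vol_S3_orthonormal:
  assumes "x \<bullet> x = 1" "y \<bullet> y = 1" "u \<bullet> u = 1" "w \<bullet> w = 1"
    "x \<bullet> y = 0" "x \<bullet> u = 0" "x \<bullet> w = 0" "y \<bullet> u = 0" "y \<bullet> w = 0" "u \<bullet> w = 0"
  shows "vol_S3 x y u w = 1 \<or> vol_S3 x y u w = -1"
proof -
  let ?M = "vector [coords x, coords y, coords u, coords w] :: real^4^4"
  have "norm (row i ?M) = 1" for i
    using exhaust_4[of i] assms
    by (auto simp: row_def vector_4_nth norm_eq_sqrt_inner coords_inner)
  moreover have "orthogonal (row i ?M) (row j ?M)" if "i \<noteq> j" for i j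
    using exhaust_4[of i] exhaust_4[of j] that assms
    by (auto simp: row_def vector_4_nth orthogonal_def coords_inner inner_commute)
  ultimately have "orthogonal_matrix ?M"
    by (simp add: orthogonal_matrix_orthonormal_rows)
  then show ?thesis
    unfolding vol_S3_def by (rule det_orthogonal_matrix)
qed

lemma expand_in_orthonormal:
  fixes z :: "'a::euclidean_space"
  assumes "pairwise orthogonal B" "\<And>b. b \<in> B \<Longrightarrow> b \<bullet> b = 1" "finite B" "card B = DIM('a)"
  shows "(\<Sum>b\<in>B. (z \<bullet> b) *\<^sub>R b) = z"
proof -
  have n: "norm b = 1" if "b \<in> B" for b
    using assms(2) that by (simp add: norm_eq_sqrt_inner)
  then have "0 \<notin> B" by force
  then have "independent B"
    using assms(1) pairwise_orthogonal_independent by blast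
  then have "span B = UNIV"
    using assms(4) by (metis dim_eq_card_independent dim_eq_full)
  then show ?thesis
    by (intro orthonormal_basis_expand assms n) auto
qed

lemma expand_in_orthonormal_C2:
  fixes x y u w z :: C2
  assumes on: "x \<bullet> x = 1" "y \<bullet> y = 1" "u \<bullet> u = 1" "w \<bullet> w = 1"
    "x \<bullet> y = 0" "x \<bullet> u = 0" "x \<bullet> w = 0" "y \<bullet> u = 0" "y \<bullet> w = 0" "u \<bullet> w = 0"
  shows "z = (z \<bullet> x) *\<^sub>R x + (z \<bullet> y) *\<^sub>R y + (z \<bullet> u) *\<^sub>R u + (z \<bullet> w) *\<^sub>R w"
proof -
  have ne: "x \<noteq> y" "x \<noteq> u" "x \<noteq> w" "y \<noteq> u" "y \<noteq> w" "u \<noteq> w"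
    using on by auto
  have "(\<Sum>b\<in>{x, y, u, w}. (z \<bullet> b) *\<^sub>R b) = z"
    using on ne by (intro expand_in_orthonormal) (auto simp: pairwise_def orthogonal_def inner_commute)
  then show ?thesis using ne by (simp add: add.assoc)
qed

lemma exists_unit_orthogonal:
  assumes "finite S" "card S < 4"
  shows "\<exists>v::C2. v \<bullet> v = 1 \<and> (\<forall>x\<in>S. x \<bullet> v = 0)"
proof -
  have "dim S < DIM(C2)"
    using assms dim_le_card'[OF assms(1)] by simp
  then obtain v where v: "v \<noteq> 0" "\<And>y. y \<in> span S \<Longrightarrow> orthogonal v y"
    using orthogonal_to_subspace_exists by blast
  then have "sgn v \<bullet> sgn v = 1" "\<forall>x\<in>S. x \<bullet> sgn v = 0"
    by (auto simp: dot_square_norm norm_sgn sgn_div_norm orthogonal_def span_base inner_commute)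
  then show ?thesis by blast
qed

lemma oriented_frame:
  assumes "x \<bullet> x = 1" "y \<bullet> y = 1" "x \<bullet> y = 0"
  obtains u w where "u \<bullet> u = 1" "w \<bullet> w = 1" "x \<bullet> u = 0" "x \<bullet> w = 0" "y \<bullet> u = 0" "y \<bullet> w = 0"
    "u \<bullet> w = 0" "vol_S3 x y u w = 1"
proof -
  have "card {x, y} < 4"
    by (rule le_less_trans[OF card_insert_le_m1]) auto
  then obtain u where u: "u \<bullet> u = 1" "x \<bullet> u = 0" "y \<bullet> u = 0"
    using exists_unit_orthogonal[of "{x, y}"] by auto
  have "card {x, y, u} < 4"
    using card_insert_le_m1[of 3 "{y,u}" x] card_insert_le_m1[of 2 "{u}" y] by auto
  then obtain w where w: "w \<bullet> w = 1" "x \<bullet> w = 0" "y \<bullet> w = 0" "u \<bullet> w = 0"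
    using exists_unit_orthogonal[of "{x, y, u}"] by auto
  \<comment> \<open>Multiplying \<open>w\<close> by the sign of the frame makes the orientation
    positive.\<close>
  define w' where "w' = vol_S3 x y u w *\<^sub>R w"
  have "vol_S3 x y u w = 1 \<or> vol_S3 x y u w = -1"
    using vol_S3_orthonormal assms u w by blast
  moreover have "vol_S3 x y u w' = vol_S3 x y u w * vol_S3 x y u w"
    using vol_S3_comb_right[of x y 1 u 0 u "vol_S3 x y u w" w 0 w] by (simp add: w'_def)
  ultimately have "vol_S3 x y u w' = 1" "w' \<bullet> w' = 1"
    using w(1) by (auto simp: w'_def)
  moreover have "x \<bullet> w' = 0" "y \<bullet> w' = 0" "u \<bullet> w' = 0"
    using w by (simp_all add: w'_def)
  ultimately show thesis using that u by blast
qed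

subsection \<open>Complements of subspaces and linear isometries\<close>

text \<open>Two points off \<open>P\<close> are joined through a third point \<open>w\<close>
  outside the spans of \<open>P\<close> with either of them. Both spans are proper, hence
  negligible, so such a \<open>w\<close> exists; a point of \<open>P\<close> on one of the segments
  would put \<open>w\<close> into a span.\<close>

lemma connected_complement_codim2:
  fixes P :: "'a::euclidean_space set"
  assumes P: "subspace P" "dim P + 2 \<le> DIM('a)"
  shows "connected (- P)"
proof (rule path_connected_imp_connected, unfold path_connected_component, intro ballI)
  have seg: "closed_segment y w \<subseteq> - P" if "y \<notin> P" "w \<notin> span (insert y P)" for y w
  proof (rule subsetI, rule ComplI)
    fix z assume "z \<in> closed_segment y w" "z \<in> P"
    then obtain t where z: "z = (1 - t) *\<^sub>R y + t *\<^sub>R w" by (auto simp: closed_segment_def)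
    show False
    proof (cases "t = 0")
      case True then show ?thesis using z \<open>z \<in> P\<close> that by simp
    next
      case False
      then have "w = (1 / t) *\<^sub>R (z - (1 - t) *\<^sub>R y)"
        using z by simp
      moreover have "z \<in> span (insert y P)" "y \<in> span (insert y P)"
        using \<open>z \<in> P\<close> by (auto intro: span_base)
      ultimately show ?thesis
        using that(2) by (metis span_diff span_scale)
    qed
  qed
  have neg: "negligible (span (insert y P))" for y
    using P(2) by (intro negligible_lowdim) (simp add: dim_insert)
  fix y z assume yz: "y \<in> - P" "z \<in> - P"
  have "span (insert y P) \<union> span (insert z P) \<noteq> UNIV"
    using negligible_Un[OF neg neg] non_negligible_UNIV by metis
  then obtain w where w: "w \<notin> span (insert y P)" "w \<notin> span (insert z P)"
    by auto
  have "path_component (- P) y w" "path_component (- P) z w"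
    using seg yz w by (auto intro!: path_component_linepath)
  then show "path_component (- P) y z"
    using path_component_sym path_component_trans by blast
qed

lemma isometry_S3_orthogonal:
  assumes f: "orthogonal_transformation f"
  shows "isometry_S3 f" and "\<And>y. y \<in> S3 \<Longrightarrow> inv_into S3 f y = inv f y"
    and "\<And>x u. x \<in> S3 \<Longrightarrow> u \<in> tangent_S3 x \<Longrightarrow> diff_S3 f x u = f u"
proof -
  let ?g = "inv f"
  have g: "orthogonal_transformation ?g"
    by (rule orthogonal_transformation_inv[OF f])
  have bij: "bij f" by (rule orthogonal_transformation_bij[OF f])
  have lin: "bounded_linear f" "bounded_linear ?g"
    using f g orthogonal_transformation_linear linear_conv_bounded_linear by blast+
  have S: "f x \<in> S3 \<longleftrightarrow> x \<in> S3" "?g x \<in> S3 \<longleftrightarrow> x \<in> S3" for x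
    by (simp_all add: S3_def orthogonal_transformation_norm[OF f] orthogonal_transformation_norm[OF g])
  have b: "bij_betw f S3 S3"
  proof -
    have "f ` S3 = S3"
    proof (intro equalityI subsetI)
      fix y assume "y \<in> S3"
      then show "y \<in> f ` S3"
        using S(2) bij by (intro image_eqI[of _ _ "?g y"]) (simp_all add: bij_is_surj surj_f_inv_f)
    qed (use S(1) in auto)
    then show ?thesis using bij inj_on_subset unfolding bij_betw_def bij_def by blast
  qed
  show inv: "inv_into S3 f y = inv f y" if "y \<in> S3" for y
    using that S b bij by (metis bij_betw_inv_into_left bij_inv_eq_iff)
  show d: "diff_S3 f x u = f u" if "x \<in> S3" "u \<in> tangent_S3 x" for x u
    using diff_S3_eq[OF bounded_linear_imp_has_derivative[OF lin(1)] that] .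
  have "smooth_S3 f" "smooth_S3 (inv_into S3 f)"
    unfolding smooth_S3_def using Ck_on_linear lin inv by (metis open_UNIV subset_UNIV)+
  then show "isometry_S3 f"
    using b f d unfolding isometry_S3_def orthogonal_transformation_def by metis
qed

text \<open>In the orthonormal basis \<open>e, J e, e', J e'\<close> the complex structure \<open>J\<close> becomes multiplication by
  \<open>\<i>\<close>; the isometry may reverse the orientation.\<close>

lemma isometry_to_hopf:
  assumes J: "orthogonal_transformation J" and perp: "\<And>x. x \<bullet> J x = 0"
    and V: "\<And>x. x \<in> S3 \<Longrightarrow> V x = J x"
  shows "\<exists>\<phi>. isometry_S3 \<phi> \<and> (\<forall>y\<in>S3. pushforward_S3 \<phi> V y = hopf y)"
proof -
  have lin: "linear J" and JJ: "J x \<bullet> J y = x \<bullet> y" for x y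
    using J unfolding orthogonal_transformation_def by blast+
  \<comment> \<open>Polarisation of \<open>perp\<close>. Together with orthogonality it gives
    \<open>J (J x) = - x\<close>.\<close>
  have skew: "x \<bullet> J y = - (J x \<bullet> y)" for x y
    using perp[of "x + y"] perp[of x] perp[of y]
    by (simp add: linear_add[OF lin] inner_add inner_commute)
  have sq: "J (J x) = - x" for x
  proof -
    have "(J (J x) + x) \<bullet> y = 0" for y
      using skew[of "J x" y] JJ[of x y] by (simp add: inner_add)
    then show ?thesis by (metis inner_eq_zero_iff eq_neg_iff_add_eq_0)
  qed
  obtain e :: C2 where e: "e \<bullet> e = 1"
    using exists_unit_orthogonal[of "{}"] by auto
  have "card {e, J e} < 4"
    by (rule le_less_trans[OF card_insert_le_m1]) auto
  then obtain e' where e': "e' \<bullet> e' = 1" "e \<bullet> e' = 0" "J e \<bullet> e' = 0"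
    using exists_unit_orthogonal[of "{e, J e}"] by auto
  have e2: "e \<bullet> J e' = 0"
    using skew[of e e'] e' by simp
  \<comment> \<open>The real coordinates of \<open>w\<close> are read in the basis adapted to
    \<open>J\<close>, so \<open>\<psi>\<close> intertwines \<open>hopf\<close> with
    \<open>J\<close>; its inverse is the required isometry.\<close>
  define \<psi> where "\<psi> w = Re (fst w) *\<^sub>R e + Im (fst w) *\<^sub>R J e + Re (snd w) *\<^sub>R e' + Im (snd w) *\<^sub>R J e'"
    for w
  have dots: "e \<bullet> J e = 0" "e' \<bullet> J e' = 0" "J e \<bullet> J e' = 0" "J e \<bullet> J e = 1" "J e' \<bullet> J e' = 1"
    using perp JJ e e' by simp_all
  have uw: "u \<bullet> w = Re (fst u) * Re (fst w) + Im (fst u) * Im (fst w)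
      + Re (snd u) * Re (snd w) + Im (snd u) * Im (snd w)" for u w :: C2
    by (simp add: inner_prod_def inner_complex_def)
  have "\<psi> u \<bullet> \<psi> w = u \<bullet> w" for u w
    unfolding \<psi>_def uw[of u w] inner_add_left inner_add_right inner_scaleR_left inner_scaleR_right
    using dots e e' e2 by (simp add: inner_commute algebra_simps)
  then have \<psi>: "orthogonal_transformation \<psi>"
    by (auto simp: orthogonal_transformation_def \<psi>_def algebra_simps intro!: linearI)
  have J\<psi>: "J (\<psi> w) = \<psi> (hopf w)" for w
    by (simp add: \<psi>_def hopf_def case_prod_beta linear_add[OF lin] linear_scale[OF lin] sq)
  have bij: "bij \<psi>" by (rule orthogonal_transformation_bij[OF \<psi>])
  let ?\<phi> = "inv \<psi>"
  have \<phi>: "orthogonal_transformation ?\<phi>"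
    by (rule orthogonal_transformation_inv[OF \<psi>])
  note iso = isometry_S3_orthogonal[OF \<phi>]
  have "pushforward_S3 ?\<phi> V y = hopf y" if y: "y \<in> S3" for y
  proof -
    have S: "\<psi> y \<in> S3"
      using y orthogonal_transformation_norm[OF \<psi>] by (simp add: S3_def)
    have "inv_into S3 ?\<phi> y = \<psi> y"
      using iso(2)[OF y] bij by (simp add: inv_inv_eq)
    then have "pushforward_S3 ?\<phi> V y = diff_S3 ?\<phi> (\<psi> y) (J (\<psi> y))"
      using V[OF S] by (simp add: pushforward_S3_def Let_def)
    also have "\<dots> = ?\<phi> (\<psi> (hopf y))"
      using iso(3)[OF S] perp by (simp add: tangent_S3_def J\<psi>[symmetric])
    also have "\<dots> = hopf y"
      using bij by (simp add: bij_is_inj)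
    finally show ?thesis .
  qed
  then show ?thesis using iso(1) by blast
qed

subsection \<open>Unit curl eigenfields\<close>

lemma S3_iff: "x \<in> S3 \<longleftrightarrow> x \<bullet> x = 1"
  by (simp add: S3_def norm_eq_sqrt_inner)

text \<open>Allows identities that hold only on the sphere to be differentiated in tangent
  directions. In the normal direction a derivative within the sphere is not determined.\<close>

lemma derivative_within_S3_unique:
  assumes "(f has_derivative f') (at x within S3)" "(g has_derivative g') (at x within S3)"
    and "\<And>y. y \<in> S3 \<Longrightarrow> f y = g y" and "x \<in> S3" "x \<bullet> u = 0"
  shows "f' u = g' u"
proof -
  have "(f has_derivative g') (at x within S3)"
    using assms by (metis has_derivative_transform)
  then show ?thesis
    using diff_S3_eq[OF _ assms(4), of f _ u] assms by (metis mem_Collect_eq tangent_S3_def)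
qed

text \<open>The eigenfield equation written with a derivative \<open>A\<close> of \<open>V\<close>.
  Each \<open>A x\<close> is defined on all of \<open>C2\<close>, but only its values on tangent
  vectors are intrinsic. The assumption \<open>cont\<close> serves to bound \<open>A\<close>
  uniformly.\<close>

locale unit_curl_field =
  fixes V :: "C2 \<Rightarrow> C2" and A :: "C2 \<Rightarrow> C2 \<Rightarrow> C2" and lam :: real
  assumes deriv: "x \<in> S3 \<Longrightarrow> (V has_derivative A x) (at x within S3)"
    and cont: "continuous_on S3 (\<lambda>x. A x v)"
    and tangent: "x \<in> S3 \<Longrightarrow> x \<bullet> V x = 0"
    and unit: "x \<in> S3 \<Longrightarrow> V x \<bullet> V x = 1"
    and lam: "lam \<noteq> 0"
    and curl: "x \<in> S3 \<Longrightarrow> x \<bullet> u = 0 \<Longrightarrow> x \<bullet> w = 0 \<Longrightarrow>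
      A x u \<bullet> w - A x w \<bullet> u = lam * vol_S3 x (V x) u w"
begin

lemma linear_A: "x \<in> S3 \<Longrightarrow> linear (A x)"
  using deriv has_derivative_linear by blast

lemma A_inner_position:
  assumes x: "x \<in> S3" and u: "x \<bullet> u = 0" shows "A x u \<bullet> x = - (u \<bullet> V x)"
proof -
  have "((\<lambda>y. y \<bullet> V y) has_derivative (\<lambda>u. x \<bullet> A x u + u \<bullet> V x)) (at x within S3)"
    by (rule derivative_eq_intros deriv x refl)+
  from derivative_within_S3_unique[OF this has_derivative_const[of 0] tangent x u]
  show ?thesis by (simp add: inner_commute)
qed

lemma A_inner_V:
  assumes x: "x \<in> S3" and u: "x \<bullet> u = 0" shows "A x u \<bullet> V x = 0"
proof -
  have "((\<lambda>y. V y \<bullet> V y) has_derivative (\<lambda>u. V x \<bullet> A x u + A x u \<bullet> V x)) (at x within S3)"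
    by (rule derivative_eq_intros deriv x refl)+
  from derivative_within_S3_unique[OF this has_derivative_const[of 1] unit x u]
  show ?thesis by (simp add: inner_commute)
qed

text \<open>With one argument equal to \<open>V x\<close> the volume form in \<open>curl\<close>
  vanishes, so \<open>A x (V x)\<close> is orthogonal to all tangent \<open>w\<close> because
  \<open>A x w\<close> is orthogonal to \<open>V x\<close>. Differentiating
  \<open>x \<bullet> V x = 0\<close> gives its normal component. This is the geodesic equation for
  orbits.\<close>

lemma A_V: assumes x: "x \<in> S3" shows "A x (V x) = - x"
proof -
  have xx: "x \<bullet> x = 1" using x by (simp add: S3_iff)
  have *: "A x (V x) \<bullet> w = 0" if "x \<bullet> w = 0" for w
    using curl[OF x tangent[OF x] that] A_inner_V[OF x that] by (simp add: vol_S3_repeat)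
  let ?d = "A x (V x) + x"
  have d: "x \<bullet> ?d = 0"
    using A_inner_position[OF x tangent[OF x]] xx unit[OF x] by (simp add: inner_add inner_commute)
  then have "?d \<bullet> ?d = 0"
    using *[OF d] by (simp add: inner_add_left)
  then show ?thesis by (simp add: eq_neg_iff_add_eq_0)
qed

text \<open>Compactness of the sphere bounds \<open>A\<close> on each basis vector; the sum of these
  bounds is the Gronwall constant.\<close>

lemma A_bound:
  obtains K where "\<And>x u. x \<in> S3 \<Longrightarrow> norm (A x u) \<le> K * norm u"
proof -
  have "compact S3" by (simp add: S3_def)
  then have "\<exists>B. \<forall>x\<in>S3. norm (A x b) \<le> B" for b
    using compact_imp_bounded[OF compact_continuous_image[OF cont]] unfolding bounded_iff by blast
  then obtain B where B: "norm (A x b) \<le> B b" if "x \<in> S3" for x b by metis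
  have "norm (A x u) \<le> (\<Sum>b\<in>Basis. B b) * norm u" if x: "x \<in> S3" for x u
  proof -
    have "A x u = A x (\<Sum>b\<in>Basis. (u \<bullet> b) *\<^sub>R b)"
      by (simp only: euclidean_representation)
    also have "\<dots> = (\<Sum>b\<in>Basis. (u \<bullet> b) *\<^sub>R A x b)"
      using linear_A[OF x] by (simp add: linear_sum linear_scale)
    also have "norm \<dots> \<le> (\<Sum>b\<in>Basis. norm u * B b)"
      by (intro sum_norm_le) (auto intro!: mult_mono B x Basis_le_norm)
    finally show ?thesis by (simp add: sum_distrib_left mult.commute)
  qed
  then show thesis by (rule that)
qed

section \<open>Orbits are great circles\<close>

lemma great_circle_in_S3:
  assumes "x \<in> S3" shows "cos t *\<^sub>R x + sin t *\<^sub>R V x \<in> S3"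
  using assms tangent[OF assms] unit[OF assms]
  by (simp add: S3_iff inner_add_left inner_add_right inner_commute power2_eq_square[symmetric])

text \<open>The defect \<open>d(t) = V(\<gamma> t) - \<gamma>' t\<close> of a great circle \<open>\<gamma>\<close> satisfies \<open>d' = - A d\<close>, so Gronwall's
  argument applies.\<close>

lemma V_great_circle_nonneg:
  assumes x: "x \<in> S3" and t: "t \<ge> 0"
  shows "V (cos t *\<^sub>R x + sin t *\<^sub>R V x) = - sin t *\<^sub>R x + cos t *\<^sub>R V x"
proof -
  define c where "c t = cos t *\<^sub>R x + sin t *\<^sub>R V x" for t
  define c' where "c' t = - sin t *\<^sub>R x + cos t *\<^sub>R V x" for t
  define d where "d t = V (c t) - c' t" for t
  obtain K where K: "\<And>x u. x \<in> S3 \<Longrightarrow> norm (A x u) \<le> K * norm u"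
    using A_bound by blast
  have cS: "c t \<in> S3" for t unfolding c_def by (rule great_circle_in_S3[OF x])
  have "(c has_derivative (\<lambda>h. h *\<^sub>R c' t)) (at t)" for t
    unfolding c_def c'_def by (auto intro!: derivative_eq_intros simp: algebra_simps)
  then have "((\<lambda>t. V (c t)) has_derivative (\<lambda>h. A (c t) (h *\<^sub>R c' t))) (at t)" for t
    using has_derivative_in_compose[of c _ t UNIV V] has_derivative_subset[OF deriv[OF cS]] cS by blast
  then have Vc: "((\<lambda>t. V (c t)) has_derivative (\<lambda>h. h *\<^sub>R A (c t) (c' t))) (at t)" for t
    by (simp add: linear_scale[OF linear_A[OF cS]])
  have "(c' has_derivative (\<lambda>h. h *\<^sub>R - c t)) (at t)" for t
    unfolding c_def c'_def by (auto intro!: derivative_eq_intros simp: algebra_simps)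
  \<comment> \<open>By \<open>A_V\<close>, the acceleration \<open>- c t\<close> equals
    \<open>A (c t) (V (c t))\<close>, so the derivative of the defect is linear in the
    defect.\<close>
  then have d': "(d has_derivative (\<lambda>h. h *\<^sub>R - A (c t) (d t))) (at t)" for t
  proof -
    have "h *\<^sub>R - A (c t) (d t) = h *\<^sub>R A (c t) (c' t) - h *\<^sub>R - c t" for h
      unfolding d_def using A_V[OF cS] by (simp add: linear_diff[OF linear_A[OF cS]] algebra_simps)
    then show ?thesis
      using has_derivative_diff[OF Vc \<open>(c' has_derivative (\<lambda>h. h *\<^sub>R - c t)) (at t)\<close>]
      by (simp only: d_def[abs_def])
  qed
  \<comment> \<open>By the bound \<open>K\<close>, the squared defect grows at rate at most
    \<open>2 * K\<close>; the exponential weight makes it nonincreasing, and it starts at 0.\<close>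
  define f where "f t = exp (- 2 * K * t) * (d t \<bullet> d t)" for t
  have f': "(f has_real_derivative
      exp (- 2 * K * t) * (- 2 * K * (d t \<bullet> d t) - 2 * (d t \<bullet> A (c t) (d t)))) (at t)" for t
    unfolding f_def has_field_derivative_def
    by (auto intro!: derivative_eq_intros d' simp: algebra_simps inner_commute)
  have "f t \<le> f 0"
  proof (rule DERIV_nonpos_imp_nonincreasing[OF t])
    fix t
    have "- (d t \<bullet> A (c t) (d t)) \<le> norm (d t) * norm (A (c t) (d t))"
      using Cauchy_Schwarz_ineq2[of "d t"] by (smt (verit))
    also have "\<dots> \<le> norm (d t) * (K * norm (d t))"
      by (intro mult_left_mono K cS) auto
    finally have "exp (- 2 * K * t) * (- 2 * K * (d t \<bullet> d t) - 2 * (d t \<bullet> A (c t) (d t))) \<le> 0"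
      by (intro mult_nonneg_nonpos) (auto simp: dot_square_norm power2_eq_square algebra_simps)
    with f' show "\<exists>y. (f has_real_derivative y) (at t) \<and> y \<le> 0" by blast
  qed
  moreover have "f 0 = 0" by (simp add: f_def d_def c_def c'_def)
  ultimately have "d t \<bullet> d t \<le> 0"
    by (simp add: f_def mult_le_0_iff)
  then have "d t = 0"
    by (metis antisym inner_eq_zero_iff inner_ge_zero)
  then show ?thesis
    by (simp add: d_def c_def c'_def)
qed

lemma V_great_circle:
  assumes x: "x \<in> S3" and ab: "a\<^sup>2 + b\<^sup>2 = (1::real)"
  shows "V (a *\<^sub>R x + b *\<^sub>R V x) = - b *\<^sub>R x + a *\<^sub>R V x"
proof -
  obtain t where "0 \<le> t" "a = cos t" "b = sin t"
    using sincos_total_2pi[OF ab] by blast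
  then show ?thesis using V_great_circle_nonneg[OF x] by blast
qed

section \<open>The flow and its action on transverse planes\<close>

lemma rotation_in_S3:
  assumes x: "x \<in> S3" and ab: "a\<^sup>2 + b\<^sup>2 = (1::real)"
  shows "a *\<^sub>R x + b *\<^sub>R V x \<in> S3"
  using great_circle_in_S3[OF x] sincos_total_2pi[OF ab] by metis

text \<open>The map taking each \<open>x\<close> to the point \<open>(a, b)\<close> of its orbit is
  a time map of the flow. The formula is the derivative in \<open>x\<close> of
  \<open>V_great_circle\<close>.\<close>

lemma A_great_circle:
  assumes x: "x \<in> S3" and ab: "a\<^sup>2 + b\<^sup>2 = (1::real)" and u: "x \<bullet> u = 0"
  shows "A (a *\<^sub>R x + b *\<^sub>R V x) (a *\<^sub>R u + b *\<^sub>R A x u) = - b *\<^sub>R u + a *\<^sub>R A x u"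
proof -
  let ?\<phi> = "\<lambda>y. a *\<^sub>R y + b *\<^sub>R V y"
  have "(?\<phi> has_derivative (\<lambda>u. a *\<^sub>R u + b *\<^sub>R A x u)) (at x within S3)"
    by (rule derivative_eq_intros deriv x refl)+
  then have L: "((\<lambda>y. V (?\<phi> y)) has_derivative (\<lambda>u. A (?\<phi> x) (a *\<^sub>R u + b *\<^sub>R A x u))) (at x within S3)"
    by (rule has_derivative_in_compose)
      (rule has_derivative_subset[OF deriv], use rotation_in_S3[OF _ ab] x in auto)
  have R: "((\<lambda>y. - b *\<^sub>R y + a *\<^sub>R V y) has_derivative (\<lambda>u. - b *\<^sub>R u + a *\<^sub>R A x u)) (at x within S3)"
    by (rule derivative_eq_intros deriv x refl)+
  show ?thesis
    using derivative_within_S3_unique[OF L R V_great_circle[OF _ ab] x u] by simp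
qed

text \<open>The flow of \<open>V\<close> preserves \<open>d (V flat)\<close>, which is \<open>lam\<close> times the transverse area form.\<close>

lemma transverse_area_invariant:
  assumes x: "x \<in> S3" and ab: "a\<^sup>2 + b\<^sup>2 = (1::real)" and u: "x \<bullet> u = 0" and w: "x \<bullet> w = 0"
  shows "vol_S3 x (V x) (a *\<^sub>R u + b *\<^sub>R A x u) (a *\<^sub>R w + b *\<^sub>R A x w) = vol_S3 x (V x) u w"
proof -
  let ?y = "a *\<^sub>R x + b *\<^sub>R V x"
  let ?T = "\<lambda>u. a *\<^sub>R u + b *\<^sub>R A x u"
  have y: "?y \<in> S3" by (rule rotation_in_S3[OF x ab])
  have perp: "?y \<bullet> ?T u = 0" if "x \<bullet> u = 0" for u
    using that A_inner_position[OF x that] A_inner_V[OF x that]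
    by (simp add: inner_add_left inner_add_right inner_commute)
  have "lam * vol_S3 ?y (V ?y) (?T u) (?T w) = A ?y (?T u) \<bullet> ?T w - A ?y (?T w) \<bullet> ?T u"
    by (rule curl[OF y perp[OF u] perp[OF w], symmetric])
  also have "\<dots> = (a\<^sup>2 + b\<^sup>2) * (A x u \<bullet> w - A x w \<bullet> u)"
    unfolding A_great_circle[OF x ab u] A_great_circle[OF x ab w]
    by (simp add: inner_add_left inner_add_right inner_commute algebra_simps power2_eq_square)
  also have "\<dots> = lam * vol_S3 x (V x) u w"
    using curl[OF x u w] ab by simp
  \<comment> \<open>The pair \<open>?y\<close>, \<open>V ?y\<close> is a rotation of
    \<open>x\<close>, \<open>V x\<close> in their plane, which has determinant 1.\<close>
  also have "vol_S3 ?y (V ?y) (?T u) (?T w) = vol_S3 x (V x) (?T u) (?T w)"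
    unfolding V_great_circle[OF x ab] vol_S3_comb_left using ab by (simp add: power2_eq_square)
  finally show ?thesis using lam by simp
qed

text \<open>The flow for a quarter turn has differential \<open>A x\<close> on tangent
  vectors.\<close>

lemma transverse_det: 
  assumes "x \<in> S3" "x \<bullet> u = 0" "x \<bullet> w = 0"
  shows "vol_S3 x (V x) (A x u) (A x w) = vol_S3 x (V x) u w"
  using transverse_area_invariant[of x 0 1 u w] assms by simp

lemma transverse_trace:
  assumes "x \<in> S3" "x \<bullet> u = 0" "x \<bullet> w = 0"
  shows "vol_S3 x (V x) u (A x w) + vol_S3 x (V x) (A x u) w = 0"
  \<comment> \<open>A rational point of the circle with nonzero product of coordinates: once the
    determinant is known, the invariance leaves \<open>a * b\<close> times the trace equal to
    0.\<close>
  using transverse_area_invariant[of x "3/5" "4/5" u w] transverse_det[OF assms] assms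
  unfolding vol_S3_comb_right by (simp add: power2_eq_square)

text \<open>\<open>A x\<close> maps the plane orthogonal to \<open>x\<close> and \<open>V x\<close>
  into itself. There it has trace 0 and determinant 1, and \<open>curl\<close> fixes its
  antisymmetric part by \<open>lam\<close>.\<close>

lemma transverse_matrix:
  assumes x: "x \<in> S3"
  obtains v w a b c where "v \<bullet> v = 1" "w \<bullet> w = 1" "x \<bullet> v = 0" "x \<bullet> w = 0" "V x \<bullet> v = 0"
    "V x \<bullet> w = 0" "v \<bullet> w = 0" "vol_S3 x (V x) v w = 1"
    "A x v = a *\<^sub>R v + c *\<^sub>R w" "A x w = b *\<^sub>R v - a *\<^sub>R w" "- a\<^sup>2 - b * c = 1" "c - b = lam"
proof -
  have xx: "x \<bullet> x = 1" using x by (simp add: S3_iff)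
  obtain v w where f: "v \<bullet> v = 1" "w \<bullet> w = 1" "x \<bullet> v = 0" "x \<bullet> w = 0" "V x \<bullet> v = 0" "V x \<bullet> w = 0"
    "v \<bullet> w = 0" "vol_S3 x (V x) v w = 1"
    using oriented_frame[OF xx unit[OF x] tangent[OF x]] by blast
  have ex: "A x u = (A x u \<bullet> v) *\<^sub>R v + (A x u \<bullet> w) *\<^sub>R w" if "x \<bullet> u = 0" "V x \<bullet> u = 0" for u
    using expand_in_orthonormal_C2[OF xx unit[OF x] f(1,2) tangent[OF x] f(3,4,5,6,7), of "A x u"]
      A_inner_position[OF x that(1)] A_inner_V[OF x that(1)] that(2) by (simp add: inner_commute)
  define a b c d where "a = A x v \<bullet> v" and "b = A x w \<bullet> v" and "c = A x v \<bullet> w" and "d = A x w \<bullet> w"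
  have Av: "A x v = a *\<^sub>R v + c *\<^sub>R w" "A x w = b *\<^sub>R v + d *\<^sub>R w"
    using ex f by (simp_all add: a_def b_def c_def d_def)
  have "a + d = 0"
    using transverse_trace[OF x f(3,4)] vol_S3_comb_right[of x "V x" 1 v 0 v b v d w]
      vol_S3_comb_right[of x "V x" a v c w 1 w 0 w] f(8)
    by (simp add: Av vol_S3_repeat)
  then have d: "d = - a" by simp
  have "a * d - c * b = 1"
    using transverse_det[OF x f(3,4)] vol_S3_combs_right[of x "V x" 0 0 a v c w 0 0 b d] f(8)
    by (simp add: Av)
  then have "- a\<^sup>2 - b * c = 1" by (simp add: d power2_eq_square mult.commute)
  moreover have "c - b = lam"
    using curl[OF x f(3,4)] f(8) by (simp add: b_def c_def)
  ultimately show thesis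
    using Av by (intro that[OF f, of a c b]) (simp_all add: d)
qed


subsection \<open>Linking of orbits\<close>

text \<open>If the linking form vanishes, the planes of the two orbits share a unit vector
  \<open>p\<close>. Both orbits pass through \<open>p\<close> and have the same velocity
  \<open>V p\<close> there, so they coincide.\<close>

lemma same_great_circle:
  assumes x: "x \<in> S3" and y: "y \<in> S3" and g: "vol_S3 x (V x) y (V y) = 0"
  obtains a b where "a\<^sup>2 + b\<^sup>2 = (1::real)" "y = a *\<^sub>R x + b *\<^sub>R V x"
proof -
  have xx: "x \<bullet> x = 1" using x by (simp add: S3_iff)
  obtain v w where f: "v \<bullet> v = 1" "w \<bullet> w = 1" "x \<bullet> v = 0" "x \<bullet> w = 0" "V x \<bullet> v = 0" "V x \<bullet> w = 0"
    "v \<bullet> w = 0" "vol_S3 x (V x) v w = 1"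
    using oriented_frame[OF xx unit[OF x] tangent[OF x]] by blast
  note ex = expand_in_orthonormal_C2[OF xx unit[OF x] f(1,2) tangent[OF x] f(3,4,5,6,7)]
  \<comment> \<open>The linking form is the minor of the components of \<open>y\<close> and
    \<open>V y\<close> transverse to the plane of \<open>x\<close>.\<close>
  have "(y \<bullet> v) * (V y \<bullet> w) - (y \<bullet> w) * (V y \<bullet> v) = 0"
    using g f(8) vol_S3_combs_right[of x "V x" "y \<bullet> x" "y \<bullet> V x" "y \<bullet> v" v "y \<bullet> w" w
        "V y \<bullet> x" "V y \<bullet> V x" "V y \<bullet> v" "V y \<bullet> w"]
    by (simp flip: ex)
  \<comment> \<open>A kernel vector of this singular matrix combines \<open>y\<close> and
    \<open>V y\<close> into a vector of the plane of \<open>x\<close>.\<close>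
  then obtain c' d' where cd': "c' \<noteq> 0 \<or> d' \<noteq> 0" "c' * (y \<bullet> v) + d' * (V y \<bullet> v) = 0"
    "c' * (y \<bullet> w) + d' * (V y \<bullet> w) = 0"
  proof (cases "y \<bullet> v = 0 \<and> V y \<bullet> v = 0")
    case True
    show ?thesis
    proof (cases "y \<bullet> w = 0 \<and> V y \<bullet> w = 0")
      case True
      then show ?thesis using that[of 1 0] \<open>y \<bullet> v = 0 \<and> _\<close> by simp
    next
      case False
      then show ?thesis using that[of "V y \<bullet> w" "- (y \<bullet> w)"] True by auto
    qed
  next
    case False
    then show ?thesis
      using that[of "V y \<bullet> v" "- (y \<bullet> v)"] \<open>_ - _ = 0\<close> by (auto simp: algebra_simps)
  qed
  define r where "r = sqrt (c'\<^sup>2 + d'\<^sup>2)"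
  have r: "r > 0" "r\<^sup>2 = c'\<^sup>2 + d'\<^sup>2"
    using cd'(1) by (auto simp: r_def sum_power2_gt_zero_iff)
  define c d where "c = c' / r" and "d = d' / r"
  have cd: "c\<^sup>2 + d\<^sup>2 = 1" "c * (y \<bullet> v) + d * (V y \<bullet> v) = 0" "c * (y \<bullet> w) + d * (V y \<bullet> w) = 0"
    using cd' r by (simp_all add: c_def d_def power_divide add_divide_distrib[symmetric])
  define p where "p = c *\<^sub>R y + d *\<^sub>R V y"
  have p: "p \<in> S3" unfolding p_def by (rule rotation_in_S3[OF y cd(1)])
  have "p \<bullet> v = 0" "p \<bullet> w = 0"
    using cd by (simp_all add: p_def inner_add_left)
  then obtain \<alpha> \<beta> where ab: "p = \<alpha> *\<^sub>R x + \<beta> *\<^sub>R V x"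
    using ex[of p] by auto
  have "\<alpha>\<^sup>2 + \<beta>\<^sup>2 = 1"
    using p xx unit[OF x] tangent[OF x]
    by (simp add: S3_iff ab inner_add_left inner_add_right inner_commute power2_eq_square)
  \<comment> \<open>\<open>V p\<close> is computed along each of the two great circles.\<close>
  then have Vp: "- d *\<^sub>R y + c *\<^sub>R V y = - \<beta> *\<^sub>R x + \<alpha> *\<^sub>R V x"
    using V_great_circle[OF x, of \<alpha> \<beta>] V_great_circle[OF y cd(1)] ab by (simp add: p_def)
  have "y = (c\<^sup>2 + d\<^sup>2) *\<^sub>R y" using cd by simp
  also have "\<dots> = c *\<^sub>R p - d *\<^sub>R (- d *\<^sub>R y + c *\<^sub>R V y)"
    by (simp add: p_def algebra_simps power2_eq_square)
  also have "\<dots> = (c * \<alpha> + d * \<beta>) *\<^sub>R x + (c * \<beta> - d * \<alpha>) *\<^sub>R V x"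
    unfolding Vp ab by (simp add: algebra_simps)
  finally have "y = (c * \<alpha> + d * \<beta>) *\<^sub>R x + (c * \<beta> - d * \<alpha>) *\<^sub>R V x" .
  moreover have "(c * \<alpha> + d * \<beta>)\<^sup>2 + (c * \<beta> - d * \<alpha>)\<^sup>2 = (c\<^sup>2 + d\<^sup>2) * (\<alpha>\<^sup>2 + \<beta>\<^sup>2)"
    by (simp add: power2_eq_square algebra_simps)
  ultimately show thesis
    using that cd(1) \<open>\<alpha>\<^sup>2 + \<beta>\<^sup>2 = 1\<close> by simp
qed

lemma continuous_V: "continuous_on S3 V"
  using deriv has_derivative_continuous_on by blast

text \<open>The sphere minus one orbit is connected, and by \<open>same_great_circle\<close> the
  linking form has no zero on it.\<close>

lemma linking_sign_fibre:
  assumes x: "x \<in> S3"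
  shows "\<exists>s. (s = 1 \<or> s = (-1::real)) \<and>
    (\<forall>y \<in> S3. y \<notin> span {x, V x} \<longrightarrow> s * vol_S3 x (V x) y (V y) > 0)"
proof -
  let ?P = "span {x, V x}"
  let ?g = "\<lambda>y. vol_S3 x (V x) y (V y)"
  have "card {x, V x} \<le> 2"
    by (rule order_trans[OF card_insert_le_m1]) auto
  then have "dim ?P \<le> 2"
    using dim_le_card'[of "{x, V x}"] by simp
  then have "connected (- ?P)"
    by (intro connected_complement_codim2) auto
  \<comment> \<open>Radial projection carries the connected complement of the plane onto the sphere
    minus the orbit.\<close>
  moreover have "continuous_on (- ?P) (sgn :: C2 \<Rightarrow> C2)"
    by (intro continuous_on_sgn continuous_on_id) (auto simp: span_zero)
  ultimately have "connected (sgn ` (- ?P))"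
    using connected_continuous_image by blast
  moreover have "sgn ` (- ?P) = S3 - ?P"
  proof (intro equalityI subsetI)
    fix y assume "y \<in> sgn ` (- ?P)"
    then obtain z where z: "y = sgn z" "z \<notin> ?P" by auto
    then have "z \<noteq> 0" using span_zero by metis
    then have "y \<in> S3" "z = norm z *\<^sub>R y"
      using z by (auto simp: S3_def norm_sgn sgn_div_norm)
    then show "y \<in> S3 - ?P"
      using z(2) by (metis DiffI span_scale)
  next
    fix y assume "y \<in> S3 - ?P"
    then show "y \<in> sgn ` (- ?P)"
      by (intro image_eqI[of _ _ y]) (auto simp: S3_def sgn_div_norm)
  qed
  ultimately have "connected (S3 - ?P)" by simp
  moreover have "continuous_on (S3 - ?P) ?g"
    unfolding vol_S3_def det_4 vector_4_nth coords_def
    by (intro continuous_intros continuous_on_subset[OF continuous_V]) auto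
  ultimately have con: "connected (?g ` (S3 - ?P))"
    using connected_continuous_image by blast
  have nz: "?g y \<noteq> 0" if y: "y \<in> S3 - ?P" for y
  proof
    assume "?g y = 0"
    then obtain a b where "y = a *\<^sub>R x + b *\<^sub>R V x"
      using same_great_circle x y by blast
    then have "y \<in> ?P" by (auto intro: span_add span_scale span_base)
    then show False using y by simp
  qed
  have "(\<forall>y \<in> S3 - ?P. ?g y > 0) \<or> (\<forall>y \<in> S3 - ?P. ?g y < 0)"
  proof (rule ccontr)
    assume "\<not> ?thesis"
    then obtain y y' where "y \<in> S3 - ?P" "?g y \<le> 0" "y' \<in> S3 - ?P" "?g y' \<ge> 0"
      by (meson not_less)
    then have "0 \<in> ?g ` (S3 - ?P)"
      using connectedD_interval[OF con] by blast
    then show False using nz by force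
  qed
  then show ?thesis by force
qed

text \<open>Given two base points, choose \<open>y\<close> off both of their orbits. The linking
  form is symmetric, so the sign at each base point agrees with the sign at \<open>y\<close>. On a
  common orbit the form is zero, hence the weak inequality.\<close>

lemma linking_sign:
  obtains s where "s = 1 \<or> s = (-1::real)"
    "\<And>x y. x \<in> S3 \<Longrightarrow> y \<in> S3 \<Longrightarrow> s * vol_S3 x (V x) y (V y) \<ge> 0"
proof -
  let ?g = "\<lambda>x y. vol_S3 x (V x) y (V y)"
  have "\<forall>x\<in>S3. \<exists>s. (s = 1 \<or> s = (-1::real)) \<and>
      (\<forall>y \<in> S3. y \<notin> span {x, V x} \<longrightarrow> s * ?g x y > 0)"
    by (intro ballI linking_sign_fibre)
  from bchoice[OF this] obtain s where s0: "\<forall>x\<in>S3. (s x = 1 \<or> s x = (-1::real)) \<and>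
      (\<forall>y \<in> S3. y \<notin> span {x, V x} \<longrightarrow> s x * ?g x y > 0)" ..
  have s: "x \<in> S3 \<Longrightarrow> s x = 1 \<or> s x = -1"
    "x \<in> S3 \<Longrightarrow> y \<in> S3 \<Longrightarrow> y \<notin> span {x, V x} \<Longrightarrow> s x * ?g x y > 0" for x y
    using s0 by simp_all
  have neg: "negligible (span {x, V x})" for x
  proof (rule negligible_lowdim)
    have "card {x, V x} \<le> 2"
      by (rule order_trans[OF card_insert_le_m1]) auto
    then show "dim (span {x, V x}) < DIM(C2)"
      using dim_le_card'[of "{x, V x}"] by simp
  qed
  have g0: "?g x y = 0" if xy: "x \<in> S3" "y \<in> S3" "y \<in> span {x, V x}" for x y
  proof -
    obtain a b where y: "y = a *\<^sub>R x + b *\<^sub>R V x"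
      using xy(3) by (auto simp: span_insert algebra_simps)
    have "a\<^sup>2 + b\<^sup>2 = 1"
      using xy(1,2) tangent[OF xy(1)] unit[OF xy(1)]
      by (simp add: S3_iff y inner_add_left inner_add_right inner_commute power2_eq_square)
    then show ?thesis
      using V_great_circle[OF xy(1)] y vol_S3_combs_right[of x "V x" a b 0 x 0 x "- b" a 0 0] by simp
  qed
  have eq: "s x = s x'" if x: "x \<in> S3" "x' \<in> S3" for x x'
  proof -
    have "span {x, V x} \<union> span {x', V x'} \<noteq> UNIV"
      using negligible_Un[OF neg neg] non_negligible_UNIV by metis
    then obtain z where z: "z \<notin> span {x, V x}" "z \<notin> span {x', V x'}" by auto
    then have "z \<noteq> 0" using span_zero by metis
    define y where "y = sgn z"
    have y: "y \<in> S3" "z = norm z *\<^sub>R y"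
      using \<open>z \<noteq> 0\<close> by (auto simp: y_def S3_def norm_sgn sgn_div_norm)
    have *: "s x = s y" if x: "x \<in> S3" and yx: "z \<notin> span {x, V x}" for x
    proof -
      have "y \<notin> span {x, V x}"
        using yx y(2) by (metis span_scale)
      then have 1: "s x * ?g x y > 0" using s(2) x y by blast
      \<comment> \<open>Otherwise \<open>g0\<close> and symmetry would make the form vanish at this
        pair.\<close>
      then have "x \<notin> span {y, V y}"
        using g0[OF y(1) x] vol_S3_swap_pairs[of y "V y" x "V x"] by auto
      then have "s y * ?g y x > 0" using s(2) x y by blast
      then show ?thesis
        using 1 s(1)[OF x] s(1)[OF y(1)] vol_S3_swap_pairs[of y "V y" x "V x"] by auto
    qed
    show ?thesis using *[OF x(1) z(1)] *[OF x(2) z(2)] by simp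
  qed
  obtain e :: C2 where "e \<in> S3"
    using exists_unit_orthogonal[of "{}"] by (auto simp: S3_iff)
  show thesis
  proof (rule that)
    show "s e = 1 \<or> s e = -1" using s(1) \<open>e \<in> S3\<close> .
    show "s e * ?g x y \<ge> 0" if "x \<in> S3" "y \<in> S3" for x y
      using eq[OF \<open>e \<in> S3\<close> that(1)] s(2)[OF that] g0[OF that] by (cases "y \<in> span {x, V x}") auto
  qed
qed

end

subsection \<open>Functions on the sphere and chiral frames\<close>

lemma great_circle_through:
  fixes x y :: C2
  assumes x: "x \<in> S3" and y: "y \<in> S3"
  obtains u t where "x \<bullet> u = 0" "u \<bullet> u = 1" "y = cos t *\<^sub>R x + sin t *\<^sub>R u"
proof -
  have xx: "x \<bullet> x = 1" "y \<bullet> y = 1" using x y by (simp_all add: S3_iff)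
  define z where "z = y - (x \<bullet> y) *\<^sub>R x"
  have xz: "x \<bullet> z = 0" using xx by (simp add: z_def inner_diff_right)
  \<comment> \<open>If \<open>y\<close> is \<open>x\<close> or \<open>- x\<close>, every unit
    tangent direction will do.\<close>
  have "\<exists>u. x \<bullet> u = 0 \<and> u \<bullet> u = 1 \<and> z = norm z *\<^sub>R u"
  proof (cases "z = 0")
    case True
    then show ?thesis using exists_unit_orthogonal[of "{x}"] by auto
  next
    case False
    then show ?thesis using xz
      by (intro exI[of _ "sgn z"]) (auto simp: sgn_div_norm dot_square_norm norm_sgn)
  qed
  then obtain u where u: "x \<bullet> u = 0" "u \<bullet> u = 1" "z = norm z *\<^sub>R u" by blast
  have yz: "y = (x \<bullet> y) *\<^sub>R x + norm z *\<^sub>R u"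
    using u(3) by (simp add: z_def)
  have "(norm z)\<^sup>2 = 1 - (x \<bullet> y)\<^sup>2"
    unfolding power2_norm_eq_inner
    by (simp add: z_def inner_diff_left inner_diff_right xx inner_commute
        power2_eq_square)
  then have "(x \<bullet> y)\<^sup>2 + (norm z)\<^sup>2 = 1" by simp
  then obtain t where "x \<bullet> y = cos t" "norm z = sin t"
    by (rule sincos_total_2pi)
  then have "y = cos t *\<^sub>R x + sin t *\<^sub>R u" using yz by simp
  then show thesis by (rule that[OF u(1,2)])
qed

lemma S3_great_circle:
  assumes "x \<in> S3" "x \<bullet> u = 0" "u \<bullet> u = 1"
  shows "cos t *\<^sub>R x + sin t *\<^sub>R u \<in> S3"
  using assms
  by (simp add: S3_iff inner_add_left inner_add_right inner_commute power2_eq_square[symmetric])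

lemma derivative_along_great_circle:
  assumes f: "\<And>x. x \<in> S3 \<Longrightarrow> (f has_derivative f' x) (at x within S3)"
    and x: "x \<in> S3" "x \<bullet> u = 0" "u \<bullet> u = 1"
  shows "((\<lambda>t. f (cos t *\<^sub>R x + sin t *\<^sub>R u)) has_vector_derivative
    f' (cos t *\<^sub>R x + sin t *\<^sub>R u) (- sin t *\<^sub>R x + cos t *\<^sub>R u)) (at t)"
proof -
  let ?c = "\<lambda>t. cos t *\<^sub>R x + sin t *\<^sub>R u"
  have c: "(?c has_derivative (\<lambda>h. h *\<^sub>R (- sin t *\<^sub>R x + cos t *\<^sub>R u))) (at t)"
    by (auto intro!: derivative_eq_intros simp: algebra_simps)
  have S: "?c t \<in> S3" for t using S3_great_circle x by blast
  have "((\<lambda>t. f (?c t)) has_derivative (\<lambda>h. f' (?c t) (h *\<^sub>R (- sin t *\<^sub>R x + cos t *\<^sub>R u)))) (at t)"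
    by (rule has_derivative_in_compose[OF c], rule has_derivative_subset[OF f[OF S]]) (use S in auto)
  then show ?thesis
    unfolding has_vector_derivative_def
    using linear_scale[OF has_derivative_linear[OF f[OF S]]] by simp
qed

lemma constant_on_S3:
  fixes f :: "C2 \<Rightarrow> 'b::real_normed_vector"
  assumes f: "\<And>x. x \<in> S3 \<Longrightarrow> (f has_derivative f' x) (at x within S3)"
    and 0: "\<And>x u. x \<in> S3 \<Longrightarrow> x \<bullet> u = 0 \<Longrightarrow> f' x u = 0"
    and x: "x \<in> S3" and y: "y \<in> S3"
  shows "f x = f y"
proof -
  obtain u t where u: "x \<bullet> u = 0" "u \<bullet> u = 1" "y = cos t *\<^sub>R x + sin t *\<^sub>R u"
    using great_circle_through[OF x y] by blast
  let ?c = "\<lambda>t. cos t *\<^sub>R x + sin t *\<^sub>R u"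
  have perp: "?c t \<bullet> (- sin t *\<^sub>R x + cos t *\<^sub>R u) = 0" for t
    using x u by (simp add: S3_iff inner_add_left inner_add_right inner_diff_left inner_diff_right inner_commute)
  have D: "((\<lambda>t. f (?c t)) has_vector_derivative 0) (at t)" for t
    using derivative_along_great_circle[of f f', OF f x u(1,2), of t]
    unfolding 0[OF S3_great_circle[OF x u(1,2)] perp] .
  have "f (?c 0) = f (?c t)"
    by (rule has_derivative_zero_unique[of UNIV "\<lambda>t. f (?c t)"])
      (use D in \<open>simp_all add: has_vector_derivative_def\<close>)
  then show ?thesis using u(3) by simp
qed

lemma critical_point_on_S3:
  fixes f :: "C2 \<Rightarrow> real"
  assumes f: "\<And>x. x \<in> S3 \<Longrightarrow> (f has_derivative f' x) (at x within S3)"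
    and min: "\<And>y. y \<in> S3 \<Longrightarrow> f x \<le> f y"
    and x: "x \<in> S3" "x \<bullet> u = 0" "u \<bullet> u = 1"
  shows "f' x u = 0"
proof -
  have "((\<lambda>t. f (cos t *\<^sub>R x + sin t *\<^sub>R u)) has_real_derivative f' x u) (at 0)"
    using derivative_along_great_circle[of f f', OF f x, of 0]
    by (simp add: has_real_derivative_iff_has_vector_derivative)
  then show ?thesis
    by (rule DERIV_local_min[where d = 1]) (simp_all add: min[OF S3_great_circle[OF x]])
qed

text \<open>In an oriented orthonormal frame \<open>x, y, v, w\<close>, the Hodge dual of \<open>x \<and> w\<close> is \<open>y \<and> v\<close> and that of
  \<open>x \<and> v\<close> is \<open>w \<and> y\<close>.\<close>

lemma chiral_part_frame:
  assumes s: "s = 1 \<or> s = -1"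
    and f: "x \<bullet> x = 1" "y \<bullet> y = 1" "v \<bullet> v = 1" "w \<bullet> w = 1"
      "x \<bullet> y = 0" "x \<bullet> v = 0" "x \<bullet> w = 0" "y \<bullet> v = 0" "y \<bullet> w = 0" "v \<bullet> w = 0"
    and vol: "vol_S3 x y v w = 1"
  shows "chiral_part s v y = - s *\<^sub>R chiral_part s x w" "chiral_part s w y = s *\<^sub>R chiral_part s x v"
proof -
  have ss: "s * s = 1" using s by auto
  have v: "vol_S3 v y x w = - vol_S3 x y v w" "vol_S3 w y x v = vol_S3 x y v w"
    "vol_S3 v y v y = 0" "vol_S3 w y w y = 0" "vol_S3 x w x w = 0" "vol_S3 x v x v = 0"
    by (simp_all add: vol_S3_def det_4 vector_4_nth coords_def algebra_simps)
  have fc: "v \<bullet> x = 0" "w \<bullet> x = 0" "v \<bullet> y = 0" "w \<bullet> y = 0" "w \<bullet> v = 0"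
    using f by (simp_all add: inner_commute)
  \<comment> \<open>The difference of the two sides has norm 0; all inner products come from
    \<open>inner_chiral_part\<close>.\<close>
  have "(chiral_part s v y + s *\<^sub>R chiral_part s x w) \<bullet> (chiral_part s v y + s *\<^sub>R chiral_part s x w)
    = chiral_part s v y \<bullet> chiral_part s v y + 2 * s * (chiral_part s v y \<bullet> chiral_part s x w)
      + s * s * (chiral_part s x w \<bullet> chiral_part s x w)"
    by (simp only: inner_add_left inner_add_right inner_scaleR_left inner_scaleR_right
        inner_commute[of "chiral_part s x w" "chiral_part s v y"]) (simp add: algebra_simps)
  also have "\<dots> = 0"
    unfolding inner_chiral_part[OF s] using ss by (simp add: f fc vol v algebra_simps)
  finally show "chiral_part s v y = - s *\<^sub>R chiral_part s x w"
    by (simp add: eq_neg_iff_add_eq_0)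
  have "(chiral_part s w y - s *\<^sub>R chiral_part s x v) \<bullet> (chiral_part s w y - s *\<^sub>R chiral_part s x v)
    = chiral_part s w y \<bullet> chiral_part s w y - 2 * s * (chiral_part s w y \<bullet> chiral_part s x v)
      + s * s * (chiral_part s x v \<bullet> chiral_part s x v)"
    by (simp only: inner_diff_left inner_diff_right inner_scaleR_left inner_scaleR_right
        inner_commute[of "chiral_part s x v" "chiral_part s w y"]) (simp add: algebra_simps)
  also have "\<dots> = 0"
    unfolding inner_chiral_part[OF s] using ss by (simp add: f fc vol v algebra_simps)
  finally show "chiral_part s w y = s *\<^sub>R chiral_part s x v"
    by simp
qed

text \<open>On the tangent space at a unit vector \<open>x\<close> the map
  \<open>chiral_part s x\<close> is therefore an isometry, so it carries an orthonormal tangent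
  frame to an orthonormal basis of the target.\<close>

lemma inner_chiral_part_same:
  assumes "s = 1 \<or> s = -1" "x \<bullet> x = 1"
  shows "chiral_part s x u \<bullet> chiral_part s x v = u \<bullet> v - (x \<bullet> u) * (x \<bullet> v)"
proof -
  have "vol_S3 x u x v = 0"
    by (simp add: vol_S3_def det_4 vector_4_nth coords_def algebra_simps)
  then show ?thesis
    unfolding inner_chiral_part[OF assms(1)] using assms(2) by (simp add: inner_commute)
qed

lemma chiral_part_expand:
  fixes n :: "real \<times> complex"
  assumes s: "s = 1 \<or> s = -1"
    and f: "x \<bullet> x = 1" "y \<bullet> y = 1" "v \<bullet> v = 1" "w \<bullet> w = 1"
      "x \<bullet> y = 0" "x \<bullet> v = 0" "x \<bullet> w = 0" "y \<bullet> v = 0" "y \<bullet> w = 0" "v \<bullet> w = 0"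
  shows "n = (n \<bullet> chiral_part s x y) *\<^sub>R chiral_part s x y
    + (n \<bullet> chiral_part s x v) *\<^sub>R chiral_part s x v + (n \<bullet> chiral_part s x w) *\<^sub>R chiral_part s x w"
proof -
  let ?q = "chiral_part s x"
  have on: "?q y \<bullet> ?q y = 1" "?q v \<bullet> ?q v = 1" "?q w \<bullet> ?q w = 1"
    "?q y \<bullet> ?q v = 0" "?q y \<bullet> ?q w = 0" "?q v \<bullet> ?q w = 0"
    using f by (simp_all add: inner_chiral_part_same[OF s f(1)])
  have ne: "?q y \<noteq> ?q v" "?q y \<noteq> ?q w" "?q v \<noteq> ?q w"
    using on by auto
  have "(\<Sum>b\<in>{?q y, ?q v, ?q w}. (n \<bullet> b) *\<^sub>R b) = n"
    using on ne by (intro expand_in_orthonormal) (auto simp: pairwise_def orthogonal_def inner_commute)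
  then show ?thesis using ne by (simp add: add.assoc)
qed

context unit_curl_field
begin

subsection \<open>The pole map of an orbit\<close>

text \<open>Oriented great circles are parametrised by a product of two 2-spheres;
  \<open>pole 1 x\<close> and \<open>pole (-1) x\<close> are the coordinates of the orbit through
  \<open>x\<close>.\<close>

definition pole :: "real \<Rightarrow> C2 \<Rightarrow> real \<times> complex"
  where "pole s x = chiral_part s x (V x)"

definition dpole :: "real \<Rightarrow> C2 \<Rightarrow> C2 \<Rightarrow> real \<times> complex"
  where "dpole s x u = chiral_part s x (A x u) + chiral_part s u (V x)"

lemma pole_derivative:
  "x \<in> S3 \<Longrightarrow> (pole s has_derivative dpole s x) (at x within S3)"
  unfolding pole_def[abs_def] dpole_def[abs_def]
  by (rule bounded_bilinear.FDERIV[OF bounded_bilinear_chiral_part has_derivative_ident deriv])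

lemma inner_pole:
  assumes "s = 1 \<or> s = -1"
  shows "pole s x \<bullet> pole s y =
    (x \<bullet> y) * (V x \<bullet> V y) - (x \<bullet> V y) * (V x \<bullet> y) + s * vol_S3 x (V x) y (V y)"
  unfolding pole_def inner_chiral_part[OF assms] ..

lemma pole_unit:
  assumes "s = 1 \<or> s = -1" "x \<in> S3" shows "pole s x \<bullet> pole s x = 1"
  using inner_pole[OF assms(1), of x x] tangent[OF assms(2)] unit[OF assms(2)] assms(2)
  by (simp add: vol_S3_repeat S3_iff)

text \<open>For antipodal values the metric and linking terms add up to -1. Their difference is an
  inner product of unit vectors, hence at least -1, so the nonnegative linking term is 0. Then both
  points lie on one orbit, where the inner product is 1.\<close>

lemma pole_not_antipodal:
  assumes s: "s = 1 \<or> s = (-1::real)"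
    and pos: "\<And>x y. x \<in> S3 \<Longrightarrow> y \<in> S3 \<Longrightarrow> s * vol_S3 x (V x) y (V y) \<ge> 0"
    and x: "x \<in> S3" and y: "y \<in> S3"
  shows "pole s x \<noteq> - pole s y"
proof
  assume "pole s x = - pole s y"
  then have m: "pole s x \<bullet> pole s y = -1" using pole_unit[OF s y] by simp
  have s': "- s = 1 \<or> - s = -1" using s by auto
  have "\<bar>pole (- s) x \<bullet> pole (- s) y\<bar> \<le> 1"
    using Cauchy_Schwarz_ineq2[of "pole (- s) x" "pole (- s) y"] pole_unit[OF s' x] pole_unit[OF s' y]
    by (simp add: norm_eq_sqrt_inner)
  then have "s * vol_S3 x (V x) y (V y) = 0"
    using m pos[OF x y] unfolding inner_pole[OF s] inner_pole[OF s'] mult_minus_left by linarith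
  then have "vol_S3 x (V x) y (V y) = 0" using s by auto
  then obtain a b where ab: "a\<^sup>2 + b\<^sup>2 = (1::real)" "y = a *\<^sub>R x + b *\<^sub>R V x"
    by (rule same_great_circle[OF x y])
  have "V y = - b *\<^sub>R x + a *\<^sub>R V x" using V_great_circle[OF x ab(1)] ab(2) by simp
  then have "pole s x \<bullet> pole s y = a\<^sup>2 + b\<^sup>2"
    unfolding inner_pole[OF s] \<open>vol_S3 x (V x) y (V y) = 0\<close>
    using tangent[OF x] unit[OF x] x
    by (simp add: ab(2) S3_iff inner_add_right inner_diff_right inner_commute power2_eq_square)
  then show False using m ab(1) by simp
qed

text \<open>By \<open>chiral_part_frame\<close>, moving the base point contributes
  \<open>- s\<close> times a quarter turn of the transverse plane, so the differential is
  \<open>A x\<close> with its off-diagonal entries shifted by \<open>s\<close>. The images of the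
  frame are orthonormal and tangent to the 2-sphere at \<open>pole s x\<close>.\<close>

lemma dpole_matrix:
  assumes s: "s = 1 \<or> s = (-1::real)" and x: "x \<in> S3"
  obtains v w a b c where "v \<bullet> v = 1" "w \<bullet> w = 1" "x \<bullet> v = 0" "x \<bullet> w = 0"
    "dpole s x v = a *\<^sub>R chiral_part s x v + (c - s) *\<^sub>R chiral_part s x w"
    "dpole s x w = (b + s) *\<^sub>R chiral_part s x v - a *\<^sub>R chiral_part s x w"
    "- a\<^sup>2 - b * c = 1" "c - b = lam"
    "\<forall>n. n = (n \<bullet> pole s x) *\<^sub>R pole s x
    + (n \<bullet> chiral_part s x v) *\<^sub>R chiral_part s x v + (n \<bullet> chiral_part s x w) *\<^sub>R chiral_part s x w"
    "\<forall>u. x \<bullet> u = 0 \<longrightarrow> (\<exists>p q r. u = p *\<^sub>R V x + q *\<^sub>R v + r *\<^sub>R w)"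
    "chiral_part s x v \<bullet> chiral_part s x v = 1" "chiral_part s x w \<bullet> chiral_part s x w = 1"
    "chiral_part s x v \<bullet> chiral_part s x w = 0"
proof -
  have xx: "x \<bullet> x = 1" using x by (simp add: S3_iff)
  obtain v w a b c where f: "v \<bullet> v = 1" "w \<bullet> w = 1" "x \<bullet> v = 0" "x \<bullet> w = 0" "V x \<bullet> v = 0"
    "V x \<bullet> w = 0" "v \<bullet> w = 0" "vol_S3 x (V x) v w = 1"
    and m: "A x v = a *\<^sub>R v + c *\<^sub>R w" "A x w = b *\<^sub>R v - a *\<^sub>R w" "- a\<^sup>2 - b * c = 1" "c - b = lam"
    by (rule transverse_matrix[OF x])
  note on = xx unit[OF x] f(1,2) tangent[OF x] f(3,4,5,6,7)
  interpret T: bounded_bilinear "chiral_part s" by (rule bounded_bilinear_chiral_part)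
  note fr = chiral_part_frame[OF s on f(8)]
  have "dpole s x v = a *\<^sub>R chiral_part s x v + (c - s) *\<^sub>R chiral_part s x w"
    unfolding dpole_def m fr by (simp add: T.add_right T.scaleR_right algebra_simps)
  moreover have "dpole s x w = (b + s) *\<^sub>R chiral_part s x v - a *\<^sub>R chiral_part s x w"
    unfolding dpole_def m fr by (simp add: T.diff_right T.scaleR_right algebra_simps)
  moreover have "\<forall>u. x \<bullet> u = 0 \<longrightarrow> (\<exists>p q r. u = p *\<^sub>R V x + q *\<^sub>R v + r *\<^sub>R w)"
    using expand_in_orthonormal_C2[OF on] by (metis add_0 inner_commute scale_zero_left)
  moreover have "chiral_part s x v \<bullet> chiral_part s x v = 1" "chiral_part s x w \<bullet> chiral_part s x w = 1"
    "chiral_part s x v \<bullet> chiral_part s x w = 0"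
    using f by (simp_all add: inner_chiral_part_same[OF s xx])
  moreover have "\<forall>n. n = (n \<bullet> pole s x) *\<^sub>R pole s x
    + (n \<bullet> chiral_part s x v) *\<^sub>R chiral_part s x v + (n \<bullet> chiral_part s x w) *\<^sub>R chiral_part s x w"
    unfolding pole_def by (intro allI chiral_part_expand[OF s on])
  ultimately show thesis
    using that[OF f(1-4) _ _ m(3,4)] by blast
qed

text \<open>A minimum of \<open>pole s x \<bullet> n\<close>, where \<open>n\<close> is a value of \<open>pole s\<close>, is not at \<open>- n\<close>,
  so the differential of \<open>pole s\<close> is singular there; its determinant is \<open>2 - s * lam\<close>.\<close>

lemma eigenvalue_eq:
  assumes s: "s = 1 \<or> s = (-1::real)"
    and pos: "\<And>x y. x \<in> S3 \<Longrightarrow> y \<in> S3 \<Longrightarrow> s * vol_S3 x (V x) y (V y) \<ge> 0"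
  shows "lam = 2 * s"
proof -
  have ss: "s * s = 1" using s by auto
  obtain e :: C2 where e: "e \<in> S3"
    using exists_unit_orthogonal[of "{}"] by (auto simp: S3_iff)
  let ?n = "pole s e"
  let ?h = "\<lambda>x. pole s x \<bullet> ?n"
  have h: "(?h has_derivative (\<lambda>u. dpole s x u \<bullet> ?n)) (at x within S3)" if "x \<in> S3" for x
    by (rule has_derivative_inner_left pole_derivative that)+
  then have "continuous_on S3 ?h"
    by (rule has_derivative_continuous_on)
  moreover have "compact S3" by (simp add: S3_def)
  ultimately obtain x where x: "x \<in> S3" and min: "\<And>y. y \<in> S3 \<Longrightarrow> ?h x \<le> ?h y"
    using continuous_attains_inf[of S3 ?h] e by blast
  obtain v w a b c where f: "v \<bullet> v = 1" "w \<bullet> w = 1" "x \<bullet> v = 0" "x \<bullet> w = 0"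
    and D: "dpole s x v = a *\<^sub>R chiral_part s x v + (c - s) *\<^sub>R chiral_part s x w"
    "dpole s x w = (b + s) *\<^sub>R chiral_part s x v - a *\<^sub>R chiral_part s x w"
    and m: "- a\<^sup>2 - b * c = 1" "c - b = lam"
    and ex: "\<forall>n. n = (n \<bullet> pole s x) *\<^sub>R pole s x
    + (n \<bullet> chiral_part s x v) *\<^sub>R chiral_part s x v + (n \<bullet> chiral_part s x w) *\<^sub>R chiral_part s x w"
    and tan: "\<forall>u. x \<bullet> u = 0 \<longrightarrow> (\<exists>p q r. u = p *\<^sub>R V x + q *\<^sub>R v + r *\<^sub>R w)"
    and q: "chiral_part s x v \<bullet> chiral_part s x v = 1" "chiral_part s x w \<bullet> chiral_part s x w = 1"
    "chiral_part s x v \<bullet> chiral_part s x w = 0"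
    by (rule dpole_matrix[OF s x])
  \<comment> \<open>At the minimum, the tangential part of \<open>?n\<close> is orthogonal to the
    image of the differential; it is a nonzero kernel vector of the transpose unless
    \<open>?n\<close> is \<open>pole s x\<close> or its antipode.\<close>
  have "\<exists>n1 n2. (n1 \<noteq> 0 \<or> n2 \<noteq> 0) \<and> a * n1 + (c - s) * n2 = 0 \<and> (b + s) * n1 - a * n2 = 0"
  proof (cases "?n = pole s x")
    \<comment> \<open>The minimum of \<open>?h\<close> is then 1, which is also its largest possible
      value, so \<open>pole s\<close> is constant and its differential vanishes.\<close>
    case True
    have "pole s y = ?n" if y: "y \<in> S3" for y
    proof -
      have "?h y \<ge> 1" using min[OF y] True pole_unit[OF s e] by simp
      then have "(pole s y - ?n) \<bullet> (pole s y - ?n) \<le> 0"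
        using pole_unit[OF s y] pole_unit[OF s e] by (simp add: inner_diff inner_commute)
      then have "pole s y - ?n = 0"
        by (metis antisym inner_eq_zero_iff inner_ge_zero)
      then show ?thesis by simp
    qed
    then have "dpole s x u = 0" if "x \<bullet> u = 0" for u
      using derivative_within_S3_unique[OF pole_derivative[OF x] has_derivative_const[of ?n] _ x that]
      by blast
    then have "dpole s x v \<bullet> chiral_part s x v = 0" "dpole s x w \<bullet> chiral_part s x v = 0"
      using f by simp_all
    then have "a = 0" "b + s = 0"
      using q inner_commute[of "chiral_part s x w" "chiral_part s x v"]
      unfolding D inner_add_left inner_diff_left by simp_all
    then show ?thesis by (intro exI[of _ 1] exI[of _ 0]) simp
  next
    case False
    define n1 n2 where "n1 = ?n \<bullet> chiral_part s x v" and "n2 = ?n \<bullet> chiral_part s x w"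
    have "n1 \<noteq> 0 \<or> n2 \<noteq> 0"
    proof (rule ccontr)
      assume "\<not> ?thesis"
      then have n: "?n = (?n \<bullet> pole s x) *\<^sub>R pole s x"
        using spec[OF ex, of ?n] by (simp add: n1_def n2_def)
      have "(?n \<bullet> pole s x)\<^sup>2 = 1"
        using pole_unit[OF s e] pole_unit[OF s x] n
        by (metis inner_scaleR_right mult.right_neutral power2_eq_square inner_commute)
      then have "?n \<bullet> pole s x = 1 \<or> ?n \<bullet> pole s x = -1"
        by (simp add: power2_eq_1_iff)
      then have "?n = pole s x \<or> ?n = - pole s x"
        using n by (metis scaleR_one scaleR_minus1_left)
      then show False
        using False pole_not_antipodal[OF s pos e x] by blast
    qed
    moreover have "dpole s x v \<bullet> ?n = 0" "dpole s x w \<bullet> ?n = 0"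
      using critical_point_on_S3[of ?h "\<lambda>x u. dpole s x u \<bullet> ?n", OF h min x] f by blast+
    then have "a * n1 + (c - s) * n2 = 0" "(b + s) * n1 - a * n2 = 0"
      unfolding D inner_add_left inner_diff_left n1_def n2_def by (simp_all add: inner_commute)
    ultimately show ?thesis by blast
  qed
  then obtain n1 n2 where n: "n1 \<noteq> 0 \<or> n2 \<noteq> 0" "a * n1 + (c - s) * n2 = 0" "(b + s) * n1 - a * n2 = 0"
    by blast
  \<comment> \<open>The determinant of the differential, equal to \<open>2 - s * lam\<close>.
    Multiplying by the adjugate shows that it annihilates \<open>n1\<close> and
    \<open>n2\<close>.\<close>
  define \<Delta> where "\<Delta> = - a\<^sup>2 - (c - s) * (b + s)"
  have "\<Delta> * n1 = - a * (a * n1 + (c - s) * n2) - (c - s) * ((b + s) * n1 - a * n2)"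
    "\<Delta> * n2 = a * ((b + s) * n1 - a * n2) - (b + s) * (a * n1 + (c - s) * n2)"
    by (simp_all add: \<Delta>_def power2_eq_square algebra_simps)
  then have "\<Delta> = 0" using n by auto
  then have "s * lam = 2"
    using m ss by (simp add: \<Delta>_def algebra_simps)
  then have "s * s * lam = s * 2" by (simp add: mult.assoc)
  then show ?thesis using ss by simp
qed

text \<open>With this eigenvalue the determinant condition on \<open>A x\<close> says that the sum
  of squares of \<open>a\<close> and \<open>c - s\<close> is 0, so the differential vanishes on the
  transverse plane. Along the orbit it vanishes by \<open>A_V\<close>.\<close>

lemma pole_constant:
  assumes s: "s = 1 \<or> s = (-1::real)" and lam_eq: "lam = 2 * s"
    and "x \<in> S3" "y \<in> S3"
  shows "pole s x = pole s y"
proof (rule constant_on_S3[OF pole_derivative _ assms(3,4)])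
  fix x u :: C2 assume x: "x \<in> S3" and u: "x \<bullet> u = 0"
  have ss: "s\<^sup>2 = 1" using s by auto
  obtain v w a b c where f: "v \<bullet> v = 1" "w \<bullet> w = 1" "x \<bullet> v = 0" "x \<bullet> w = 0"
    and D: "dpole s x v = a *\<^sub>R chiral_part s x v + (c - s) *\<^sub>R chiral_part s x w"
    "dpole s x w = (b + s) *\<^sub>R chiral_part s x v - a *\<^sub>R chiral_part s x w"
    and m: "- a\<^sup>2 - b * c = 1" "c - b = lam"
    and ex: "\<forall>n. n = (n \<bullet> pole s x) *\<^sub>R pole s x
    + (n \<bullet> chiral_part s x v) *\<^sub>R chiral_part s x v + (n \<bullet> chiral_part s x w) *\<^sub>R chiral_part s x w"
    and tan: "\<forall>u. x \<bullet> u = 0 \<longrightarrow> (\<exists>p q r. u = p *\<^sub>R V x + q *\<^sub>R v + r *\<^sub>R w)"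
    and q: "chiral_part s x v \<bullet> chiral_part s x v = 1" "chiral_part s x w \<bullet> chiral_part s x w = 1"
    "chiral_part s x v \<bullet> chiral_part s x w = 0"
    by (rule dpole_matrix[OF s x])
  have "b = c - 2 * s" using m(2) lam_eq by simp
  then have "a\<^sup>2 + (c - s)\<^sup>2 = 0"
    using m(1) ss unfolding \<open>b = c - 2 * s\<close> by (simp add: power2_eq_square algebra_simps)
  then have "a = 0" "c = s" by (simp_all add: sum_power2_eq_zero_iff)
  then have 0: "dpole s x v = 0" "dpole s x w = 0"
    using \<open>b = c - 2 * s\<close> by (simp_all add: D)
  interpret T: bounded_bilinear "chiral_part s" by (rule bounded_bilinear_chiral_part)
  have "dpole s x (V x) = 0"
    by (simp add: dpole_def A_V[OF x] T.minus_right chiral_part_self)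
  moreover obtain p q r where "u = p *\<^sub>R V x + q *\<^sub>R v + r *\<^sub>R w"
    using tan u by blast
  moreover have "linear (dpole s x)"
    using pole_derivative[OF x] has_derivative_linear by blast
  ultimately show "dpole s x u = 0"
    using 0 by (simp add: linear_add linear_scale)
qed

text \<open>A constant chiral part determines \<open>V\<close>: contracting it with the bilinear
  \<open>chiral_part s x w\<close> is linear in \<open>x\<close> and represents \<open>V x\<close>
  on the sphere. The form is alternating, hence \<open>J\<close> is skew; it preserves norms by
  homogeneity.\<close>

lemma field_is_linear:
  assumes s: "s = 1 \<or> s = (-1::real)" and lam_eq: "lam = 2 * s"
  obtains J where "orthogonal_transformation J" "\<And>x. x \<bullet> J x = 0" "\<And>x. x \<in> S3 \<Longrightarrow> V x = J x"
proof -
  interpret T: bounded_bilinear "chiral_part s" by (rule bounded_bilinear_chiral_part)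
  obtain e :: C2 where e: "e \<in> S3"
    using exists_unit_orthogonal[of "{}"] by (auto simp: S3_iff)
  define J where "J x = (\<Sum>b\<in>Basis. (chiral_part s x b \<bullet> pole s e) *\<^sub>R b)" for x
  have J: "linear J"
    unfolding J_def
    by (intro linearI) (simp_all add: T.add_left T.scaleR_left inner_add_left algebra_simps
        sum.distrib scaleR_sum_right)
  have Jw: "J x \<bullet> w = chiral_part s x w \<bullet> pole s e" for x w
  proof -
    have "J x \<bullet> w = (\<Sum>b\<in>Basis. (chiral_part s x b \<bullet> pole s e) * (b \<bullet> w))"
      by (simp add: J_def inner_sum_left)
    also have "\<dots> = chiral_part s x (\<Sum>b\<in>Basis. (w \<bullet> b) *\<^sub>R b) \<bullet> pole s e"
      by (simp only: T.sum_right T.scaleR_right inner_sum_left inner_scaleR_left)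
        (simp add: inner_commute mult.commute)
    finally show ?thesis by (simp only: euclidean_representation)
  qed
  have VJ: "V x = J x" if x: "x \<in> S3" for x
  proof -
    have "J x \<bullet> w = V x \<bullet> w" for w
    proof -
      \<comment> \<open>Constancy moves the base point from \<open>e\<close> to \<open>x\<close>,
        where \<open>inner_chiral_part\<close> applies with a vanishing volume term.\<close>
      have "J x \<bullet> w = chiral_part s x w \<bullet> pole s x"
        using Jw pole_constant[OF s lam_eq e x] by simp
      also have "\<dots> = w \<bullet> V x"
        unfolding pole_def inner_chiral_part[OF s] using tangent[OF x] x
        by (simp add: S3_iff vol_S3_def det_4 vector_4_nth coords_def algebra_simps)
      finally show ?thesis by (simp add: inner_commute)
    qed
    then show ?thesis by (metis vector_eq_rdot)
  qed
  have "norm (J x) = norm x" for x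
  proof (cases "x = 0")
    case False
    then have S: "sgn x \<in> S3" by (simp add: S3_def norm_sgn)
    have "norm (J (sgn x)) = 1"
      using VJ[OF S] unit[OF S] by (simp add: norm_eq_sqrt_inner)
    moreover have "J x = norm x *\<^sub>R J (sgn x)"
      using False by (simp add: sgn_div_norm linear_scale[OF J])
    ultimately show ?thesis by simp
  qed (simp add: linear_0[OF J])
  then have "orthogonal_transformation J"
    using J by (simp add: orthogonal_transformation)
  moreover have "x \<bullet> J x = 0" for x
    using Jw[of x x] by (simp add: inner_commute chiral_part_self)
  ultimately show thesis using that VJ by blast
qed

end

section \<open>From curl eigenfields to the locale, and the classification\<close>

lemma unit_curl_field_curl_eigenfield:
  assumes V: "curl_eigenfield V lam" and unit: "\<forall>x\<in>S3. norm (V x) = 1"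
  shows "\<exists>A. unit_curl_field V A lam"
proof -
  have sm: "smooth_S3 V" and curl: "has_curl V (\<lambda>x. lam *\<^sub>R V x)" and lam: "lam \<noteq> 0"
    using V unfolding curl_eigenfield_def vector_field_S3_def by blast+
  have tan: "x \<bullet> V x = 0" if "x \<in> S3" for x
    using V that unfolding curl_eigenfield_def vector_field_S3_def tangent_S3_def by blast
  obtain U F where U: "S3 \<subseteq> U" and F: "\<forall>k. Ck_on k F U" "\<forall>x\<in>S3. F x = V x"
    using sm[unfolded smooth_S3_def] by (elim exE conjE)
  \<comment> \<open>The derivative of a smooth extension is continuous in \<open>x\<close>, and on
    the sphere it is a derivative of \<open>V\<close> within the sphere.\<close>
  let ?A = "\<lambda>x. frechet_derivative F (at x)"
  have "Ck_on (Suc 0) F U" using F(1) by (rule spec)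
  then have C1: "\<And>x. x \<in> U \<Longrightarrow> F differentiable (at x)" "\<And>v. continuous_on U (\<lambda>x. ?A x v)"
    unfolding Ck_on.simps by blast+
  have d: "(V has_derivative ?A x) (at x within S3)" if x: "x \<in> S3" for x
  proof -
    have "(F has_derivative ?A x) (at x)"
      using C1(1)[of x] x U frechet_derivative_works[of F] by blast
    then have "(F has_derivative ?A x) (at x within S3)"
      by (rule has_derivative_at_withinI)
    then show ?thesis
      by (rule has_derivative_transform[OF x, rotated]) (use F(2) in simp)
  qed
  have "unit_curl_field V ?A lam"
  proof
    fix x :: C2 assume x: "x \<in> S3"
    show "(V has_derivative ?A x) (at x within S3)" by (rule d[OF x])
    show "x \<bullet> V x = 0" by (rule tan[OF x])
    show "V x \<bullet> V x = 1" using unit x by (simp add: dot_square_norm)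
    fix u w assume u: "x \<bullet> u = 0" and w: "x \<bullet> w = 0"
    have t: "u \<in> tangent_S3 x" "w \<in> tangent_S3 x" using u w by (simp_all add: tangent_S3_def)
    have "diff_S3 (\<lambda>y. V y \<bullet> b) x a = ?A x a \<bullet> b" if "a \<in> tangent_S3 x" for a b
      by (rule diff_S3_eq[OF has_derivative_inner_left[OF d[OF x]] x that])
    then have "ext_deriv_S3 (flat_S3 V) x u w = ?A x u \<bullet> w - ?A x w \<bullet> u"
      using t by (simp add: ext_deriv_S3_def flat_S3_def)
    then show "?A x u \<bullet> w - ?A x w \<bullet> u = lam * vol_S3 x (V x) u w"
      using curl x t unfolding has_curl_def vol_S3_scale by simp
  next
    show "continuous_on S3 (\<lambda>x. ?A x v)" for v
      by (rule continuous_on_subset[OF C1(2) U])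
  qed (rule lam)
  then show ?thesis by blast
qed

theorem proposition1:
  fixes V :: "complex \<times> complex \<Rightarrow> complex \<times> complex" and lam :: real
  assumes "curl_eigenfield V lam"
    and "\<forall>x\<in>S3. norm (V x) = 1"
  shows "(lam = 2 \<or> lam = -2) \<and>
    (\<exists>\<phi>. isometry_S3 \<phi> \<and>
      ((\<forall>y\<in>S3. pushforward_S3 \<phi> V y = hopf y) \<or>
       (\<forall>y\<in>S3. pushforward_S3 \<phi> V y = anti_hopf y)))"
proof -
  obtain A where "unit_curl_field V A lam"
    using unit_curl_field_curl_eigenfield[OF assms] by blast
  then interpret unit_curl_field V A lam .
  obtain s where s: "s = 1 \<or> s = (-1::real)"
    and pos: "\<And>x y. x \<in> S3 \<Longrightarrow> y \<in> S3 \<Longrightarrow> s * vol_S3 x (V x) y (V y) \<ge> 0"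
    using linking_sign by blast
  have lam: "lam = 2 * s" by (rule eigenvalue_eq[OF s pos])
  obtain J where J: "orthogonal_transformation J" "\<And>x. x \<bullet> J x = 0" "\<And>x. x \<in> S3 \<Longrightarrow> V x = J x"
    using field_is_linear[OF s lam] by blast
  have "lam = 2 \<or> lam = -2" using s lam by auto
  \<comment> \<open>Isometries may reverse orientation, so the Hopf field serves for both signs of
    \<open>lam\<close>.\<close>
  moreover have "\<exists>\<phi>. isometry_S3 \<phi> \<and> (\<forall>y\<in>S3. pushforward_S3 \<phi> V y = hopf y)"
    by (rule isometry_to_hopf[OF J])
  ultimately show ?thesis by blast
qed

end
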